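(* Let $s>\frac12$. Then, for every $N\ge1$ and all $\varphi\in\mathcal{H}_s$, $$|b_N(\varphi)|\le\frac{\|\varphi\|_{\mathcal{H}_s}}{2\pi^{3/2}\,\Gamma(2s)^{1/2}}\bigg(\int_0^{+\infty}e^{-y}y^{2s-1}\int_{\mathbb{R}}|\beta_N(x+iy)|^2\,dx\,dy\bigg)^{1/2},$$ where $\Gamma$ is Euler's Gamma function, $b_N(\varphi)=N\big(\mathbb{E}[\int_{\mathbb{R}}\varphi\,d\mu_N]-\int_{\mathbb{R}}\varphi\,d\rho_N\big)$ and $\beta_N(z)=b_N(\varphi_z)$ with $\varphi_z:x\mapsto(z-x)^{-1}$, $z\in\mathbb{C}\setminus\mathbb{R}$.
   Context: Model. On a probability space, for each $N\ge1$, $X_N=W_N+D_N$ where $W_N=(W_{ij})_{1\le i,j\le N}$ is a random $N\times N$ Hermitian matrix (entries depend on $N$) and: the entries $\{W_{ij}\}_{1\le i\le j\le N}$ are independent; the off-diagonal entries $W_{ij}$, $i<j$, are identically distributed complex random variables with $\mathbb{E}[W_{ij}]=0$ and, for some $\varepsilon>0$, $\sup_{N\ge1}\mathbb{E}[|\sqrt N W_{ij}|^{4(1+\varepsilon)}]<+\infty$; setting, for $i<j$, $\sigma_N^2=\mathbb{E}[|W_{ij}|^2]$, $\tau_N=\mathbb{E}[W_{ij}^2]$ (assumed real), $\kappa_N=\mathbb{E}[|W_{ij}|^4]-2\sigma_N^4-\tau_N^2$, one has $N\sigma_N^2\to\sigma^2>0$, $N\tau_N\to\tau\in\mathbb{R}$,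 $N^2\kappa_N\to\kappa\in\mathbb{R}$; the diagonal entries $W_{ii}$ are identically distributed real random variables with $\mathbb{E}[W_{ii}]=0$, $\sup_{N\ge1}\mathbb{E}[|\sqrt N W_{ii}|^{2(1+\varepsilon)}]<+\infty$ for some $\varepsilon>0$, and $s_N^2=\mathbb{E}[W_{ii}^2]$ satisfies $Ns_N^2\to s^2\ge0$ (this constant is unrelated to the Sobolev index $s$); $D_N$ is a deterministic real diagonal $N\times N$ matrix whose empirical spectral measure $\nu_N=\frac1N\sum_{\lambda\in\mathrm{sp}(D_N)}\delta_\lambda$ converges weakly to a Borel probability measure $\nu_\infty$ on $\mathbb{R}$. $\mu_N=\frac1N\sum_{\lambda\in\mathrm{sp}(X_N)}\delta_\lambda$ (with multiplicity). $G_\mu(z)=\int_{\mathbb{R}}\frac{\mu(dx)}{z-x}$. $\rho_N$ is the unique Borel probability measure on $\mathbb{R}$ with $G_{\rho_N}(z)=G_{\nu_N}(z-N\sigma_N^2G_{\rho_N}(z))$, $z\in\mathbb{C}\setminus\mathbb{R}$. For $s>0$, $\mathcal{H}_s$ is the space of $f\in L^2(\mathbb{R})$ with $\|f\|_{\mathcal{H}_s}=\big(\int_{\mathbb{R}}(1+2|t|)^{2s}|\hat f(t)|^2dt\big)^{1/2}<\infty$, where $\hat f(t)=\int_{\mathbb R} f(x)e^{-itx}dx$. For $s>1/2$ each element of $\mathcal{H}_s$ has a unique bounded continuous representative, which is used to define integrals of $\varphi\in\mathcal{H}_s$ against measures. The right-hand side of the inequality is allowed to be $+\infty$. *)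

theory Defs
  imports
    "HOL-Probability.Probability"
    "Jordan_Normal_Form.Char_Poly"
    "Jordan_Normal_Form.Schur_Decomposition"
begin

section \<open>Spectral measures and Cauchy transforms\<close>

text \<open>Only used for Hermitian matrices of positive size: their eigenvalues are real, so \<open>Re\<close> is
  a mere coercion. The multiset of roots of the characteristic polynomial counts eigenvalues with
  multiplicity.\<close>

definition spectral_measure :: "complex mat \<Rightarrow> real measure" where
  "spectral_measure A =
     distr (measure_pmf (pmf_of_multiset (image_mset Re (proots (char_poly A))))) borel (\<lambda>x. x)"

definition cauchy_transform :: "real measure \<Rightarrow> complex \<Rightarrow> complex" where
  "cauchy_transform \<mu> z = (LINT x|\<mu>. 1 / (z - complex_of_real x))"

text \<open>There is exactly one such \<open>\<rho>\<close>, namely the free convolution of \<open>\<nu>\<close> with the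
  centred semicircle law of variance \<open>v\<close>.\<close>

definition semicircular_deformation :: "real measure \<Rightarrow> real \<Rightarrow> real measure \<Rightarrow> bool" where
  "semicircular_deformation \<nu> v \<rho> \<longleftrightarrow>
     real_distribution \<rho> \<and>
     (\<forall>z. Im z \<noteq> 0 \<longrightarrow>
        cauchy_transform \<rho> z
          = cauchy_transform \<nu> (z - complex_of_real v * cauchy_transform \<rho> z))"


section \<open>The random matrix model\<close>

definition deformed_matrix :: "(nat \<Rightarrow> 'a \<Rightarrow> complex mat) \<Rightarrow> (nat \<Rightarrow> real mat) \<Rightarrow> nat \<Rightarrow> 'a \<Rightarrow> complex mat"
  where "deformed_matrix W D N \<omega> = W N \<omega> + map_mat complex_of_real (D N)"

text \<open>Matrix indices start at 0. The moments \<open>sigma N\<close>, \<open>tau N\<close>, \<open>kappa N\<close> of the off-diagonal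
  entries are parameters constrained for all index pairs \<open>i < j < N\<close>; a matrix of size 1 has no
  off-diagonal entry, so their values at \<open>N = 1\<close> are arbitrary.\<close>

locale deformed_wigner = prob_space M for M :: "'a measure" +
  fixes W :: "nat \<Rightarrow> 'a \<Rightarrow> complex mat"
    and D :: "nat \<Rightarrow> real mat"
    and sigma tau kappa diag_dev :: "nat \<Rightarrow> real"
    and sigma_lim tau_lim kappa_lim diag_dev_lim :: real
    and nu_lim :: "real measure"
  assumes W_carrier: "\<And>N \<omega>. N \<ge> 1 \<Longrightarrow> \<omega> \<in> space M \<Longrightarrow> W N \<omega> \<in> carrier_mat N N"
    and W_hermitian: "\<And>N \<omega>. N \<ge> 1 \<Longrightarrow> \<omega> \<in> space M \<Longrightarrow> mat_adjoint (W N \<omega>) = W N \<omega>"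
    and W_indep: "\<And>N. N \<ge> 1 \<Longrightarrow>
      indep_vars (\<lambda>_. borel) (\<lambda>(i, j) \<omega>. W N \<omega> $$ (i, j)) {(i, j). i \<le> j \<and> j < N}"
    and offdiag_ident: "\<And>N i j k l. i < j \<Longrightarrow> j < N \<Longrightarrow> k < l \<Longrightarrow> l < N \<Longrightarrow>
      distr M borel (\<lambda>\<omega>. W N \<omega> $$ (i, j)) = distr M borel (\<lambda>\<omega>. W N \<omega> $$ (k, l))"
    and offdiag_mean: "\<And>N i j. i < j \<Longrightarrow> j < N \<Longrightarrow> expectation (\<lambda>\<omega>. W N \<omega> $$ (i, j)) = 0"
    and offdiag_moment: "\<exists>\<epsilon>>0.
      (SUP (N, i, j) \<in> {(N, i, j). i < j \<and> j < N}.
         \<integral>\<^sup>+ \<omega>. ennreal (cmod (complex_of_real (sqrt (real N)) * W N \<omega> $$ (i, j)) powr (4 * (1 + \<epsilon>))) \<partial>M) < \<infinity>"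
    and sigma: "\<And>N i j. i < j \<Longrightarrow> j < N \<Longrightarrow>
      expectation (\<lambda>\<omega>. (cmod (W N \<omega> $$ (i, j)))\<^sup>2) = (sigma N)\<^sup>2"
    and tau: "\<And>N i j. i < j \<Longrightarrow> j < N \<Longrightarrow>
      expectation (\<lambda>\<omega>. (W N \<omega> $$ (i, j))\<^sup>2) = complex_of_real (tau N)"
    and kappa: "\<And>N i j. i < j \<Longrightarrow> j < N \<Longrightarrow>
      expectation (\<lambda>\<omega>. (cmod (W N \<omega> $$ (i, j))) ^ 4) - 2 * (sigma N) ^ 4 - (tau N)\<^sup>2 = kappa N"
    and sigma_lim_pos: "(sigma_lim)\<^sup>2 > 0"
    and sigma_tendsto: "(\<lambda>N. real N * (sigma N)\<^sup>2) \<longlonglongrightarrow> (sigma_lim)\<^sup>2"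
    and tau_tendsto: "(\<lambda>N. real N * tau N) \<longlonglongrightarrow> tau_lim"
    and kappa_tendsto: "(\<lambda>N. (real N)\<^sup>2 * kappa N) \<longlonglongrightarrow> kappa_lim"
    and diag_ident: "\<And>N i k. i < N \<Longrightarrow> k < N \<Longrightarrow>
      distr M borel (\<lambda>\<omega>. W N \<omega> $$ (i, i)) = distr M borel (\<lambda>\<omega>. W N \<omega> $$ (k, k))"
    and diag_mean: "\<And>N i. i < N \<Longrightarrow> expectation (\<lambda>\<omega>. W N \<omega> $$ (i, i)) = 0"
    and diag_moment: "\<exists>\<epsilon>>0.
      (SUP (N, i) \<in> {(N, i). i < N}.
         \<integral>\<^sup>+ \<omega>. ennreal (cmod (complex_of_real (sqrt (real N)) * W N \<omega> $$ (i, i)) powr (2 * (1 + \<epsilon>))) \<partial>M) < \<infinity>"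
    and diag_dev: "\<And>N i. i < N \<Longrightarrow>
      expectation (\<lambda>\<omega>. (W N \<omega> $$ (i, i))\<^sup>2) = complex_of_real ((diag_dev N)\<^sup>2)"
    and diag_dev_tendsto: "(\<lambda>N. real N * (diag_dev N)\<^sup>2) \<longlonglongrightarrow> (diag_dev_lim)\<^sup>2"
    and D_carrier: "\<And>N. N \<ge> 1 \<Longrightarrow> D N \<in> carrier_mat N N"
    and D_diagonal: "\<And>N. N \<ge> 1 \<Longrightarrow> diagonal_mat (D N)"
    and nu_lim: "real_distribution nu_lim"
    and D_tendsto: "weak_conv_m (\<lambda>N. spectral_measure (map_mat complex_of_real (D N))) nu_lim"


section \<open>Sobolev spaces\<close>

definition square_integrable :: "(real \<Rightarrow> complex) \<Rightarrow> bool" where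
  "square_integrable f \<longleftrightarrow>
     f \<in> borel_measurable lborel \<and> integrable lborel (\<lambda>x. (cmod (f x))\<^sup>2)"

text \<open>On square-integrable functions the Fourier integral is the limit in \<open>L\<^sup>2\<close> of the truncated
  integrals. By Plancherel's theorem the limit always exists, and it is unique almost everywhere,
  so the choice made in \<open>fourier_L2\<close> does not matter below.\<close>

definition has_fourier_L2 :: "(real \<Rightarrow> complex) \<Rightarrow> (real \<Rightarrow> complex) \<Rightarrow> bool" where
  "has_fourier_L2 f g \<longleftrightarrow>
     square_integrable f \<and> square_integrable g \<and>
     ((\<lambda>R::real. \<integral>\<^sup>+ t. ennreal ((cmod (g t -
          (LINT x:{-R..R}|lborel. f x * exp (- (\<i> * complex_of_real t * complex_of_real x)))))\<^sup>2) \<partial>lborel)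
        \<longlongrightarrow> 0) at_top"

definition fourier_L2 :: "(real \<Rightarrow> complex) \<Rightarrow> real \<Rightarrow> complex" where
  "fourier_L2 f = (SOME g. has_fourier_L2 f g)"

definition sobolev :: "real \<Rightarrow> (real \<Rightarrow> complex) set" where
  "sobolev s = {f. square_integrable f \<and>
     (\<exists>g. has_fourier_L2 f g \<and>
        (\<integral>\<^sup>+ t. ennreal ((1 + 2 * \<bar>t\<bar>) powr (2 * s) * (cmod (g t))\<^sup>2) \<partial>lborel) < \<infinity>)}"

definition sobolev_norm :: "real \<Rightarrow> (real \<Rightarrow> complex) \<Rightarrow> real" where
  "sobolev_norm s f =
     sqrt (LINT t|lborel. (1 + 2 * \<bar>t\<bar>) powr (2 * s) * (cmod (fourier_L2 f t))\<^sup>2)"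

definition continuous_rep :: "(real \<Rightarrow> complex) \<Rightarrow> real \<Rightarrow> complex" where
  "continuous_rep f =
     (THE g. continuous_on UNIV g \<and> bounded (range g) \<and> (AE x in lborel. g x = f x))"


section \<open>The bias of linear statistics\<close>

definition bias :: "'a measure \<Rightarrow> (nat \<Rightarrow> 'a \<Rightarrow> complex mat) \<Rightarrow> (nat \<Rightarrow> real measure) \<Rightarrow> nat
    \<Rightarrow> (real \<Rightarrow> complex) \<Rightarrow> complex" where
  "bias M X \<rho> N \<phi> = of_nat N *
     ((LINT \<omega>|M. LINT x|spectral_measure (X N \<omega>). continuous_rep \<phi> x)
        - (LINT x|\<rho> N. continuous_rep \<phi> x))"

definition bias_resolvent :: "'a measure \<Rightarrow> (nat \<Rightarrow> 'a \<Rightarrow> complex mat) \<Rightarrow> (nat \<Rightarrow> real measure) \<Rightarrow> nat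
    \<Rightarrow> complex \<Rightarrow> complex" where
  "bias_resolvent M X \<rho> N z = bias M X \<rho> N (\<lambda>x. 1 / (z - complex_of_real x))"

definition ennreal_sqrt :: "ennreal \<Rightarrow> ennreal" where
  "ennreal_sqrt x = (if x = \<infinity> then \<infinity> else ennreal (sqrt (enn2real x)))"

end

theory Submission
  imports Defs
begin

text \<open>Both sides of the inequality are Fourier integrals of one function. Averaging the random
  spectral measure over the probability space gives a probability measure \<open>\<eta>\<close>, and the bias of a
  bounded continuous function is its integral against the signed measure \<open>N (\<eta> - \<rho>)\<close>. Put
  \<open>\<psi> t = N (char \<eta> t - char \<rho> t)\<close>, a bounded continuous function with \<open>\<psi> (- t) = cnj (\<psi> t)\<close>.

  For \<open>\<phi>\<close> in the Sobolev space with \<open>s > 1/2\<close>, the transform \<open>g\<close> of \<open>\<phi>\<close> is integrable, so Fourier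
  inversion holds pointwise for the continuous representative and the bias is
  \<open>(1/2\<pi>) \<integral> g \<psi>\<close>. The Cauchy-Schwarz inequality with the weights \<open>(1 + 2\<bar>t\<bar>) powr (\<plusminus> s)\<close> bounds its
  modulus by \<open>(1/2\<pi>) \<parallel>\<phi>\<parallel> sqrt A\<close> with \<open>A = \<integral> (1 + 2\<bar>t\<bar>) powr (- 2 s) \<bar>\<psi> t\<bar>\<^sup>2\<close>
  (\<open>sobolev_duality\<close>).

  For \<open>y > 0\<close>, the formula \<open>1 / (z - l) = - \<i> \<integral>\<^sub>0\<^sup>\<infinity> exp (\<i> t (z - l)) dt\<close> exhibits \<open>x \<mapsto> \<beta> (x + \<i> y)\<close> as
  \<open>- \<i>\<close> times the Fourier transform of \<open>exp (- y t) \<psi> (- t)\<close> on the positive half line. Plancherel's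
  theorem computes its \<open>L\<^sup>2\<close> norm, and integrating over \<open>y\<close> against \<open>exp (- y) y powr (2 s - 1)\<close> produces
  a Gamma integral: the double integral in the statement equals \<open>\<pi> Gamma (2 s) A\<close>
  (\<open>resolvent_energy\<close>). Eliminating \<open>A\<close> gives the stated constant.

  Three pieces of theory carry this. Fourier analysis on the line is developed from the
  multiplication formula \<open>\<integral> u v^ = \<integral> u^ v\<close> and the Gaussian, whose transform is known explicitly:
  Plancherel's theorem for bounded, almost everywhere continuous integrable functions
  (\<open>plancherel_bounded\<close>) and inversion for square-integrable functions with integrable transform
  (\<open>fourier_inversion_L2\<close>). The mean measure \<open>\<eta>\<close> exists because the spectral measure is a
  measurable function of the Hermitian matrix (\<open>spectral_measure_measurable\<close>): its moments are
  normalised traces of powers, hence polynomial in the entries, and Weierstrass approximation passes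
  from moments to all Borel sets.\<close>

section \<open>Fourier integrals and the multiplication formula\<close>

text \<open>The sign convention is that of \<^const>\<open>char\<close>, so that characteristic functions of densities
  are Fourier integrals; the transform of \<^const>\<open>has_fourier_L2\<close> is recovered at \<open>- t\<close>.\<close>

definition fourier :: "(real \<Rightarrow> complex) \<Rightarrow> real \<Rightarrow> complex" where
  "fourier f t = (LINT x|lborel. f x * iexp (t * x))"

lemma borel_measurable_cnj [measurable]: "cnj \<in> borel_measurable borel"
  by (intro borel_measurable_continuous_onI continuous_intros)

lemma integrable_times_iexp:
  assumes "integrable M f" "g \<in> borel_measurable M"
  shows "integrable M (\<lambda>x. f x * iexp (g x))"
  by (rule Bochner_Integration.integrable_bound[OF assms(1)]) (use assms in \<open>auto simp: norm_mult\<close>)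

lemma fourier_measurable [measurable]:
  assumes [measurable]: "f \<in> borel_measurable borel"
  shows "fourier f \<in> borel_measurable borel"
  unfolding fourier_def by measurable

lemma fourier_bound:
  "norm (fourier f t) \<le> (LINT x|lborel. norm (f x))"
  unfolding fourier_def
  using integral_norm_bound[of lborel "\<lambda>x. f x * iexp (t * x)"]
  by (simp add: norm_mult del: of_real_mult)

lemma fourier_continuous:
  assumes f: "integrable lborel f"
  shows "continuous_on UNIV (fourier f)"
proof -
  have "isCont (fourier f) t" for t
    unfolding continuous_at_sequentially
  proof safe
    fix X assume X: "X \<longlonglongrightarrow> t"
    have [measurable]: "f \<in> borel_measurable borel" using f by auto
    show "(fourier f \<circ> X) \<longlonglongrightarrow> fourier f t"
      unfolding comp_def fourier_def
      by (rule integral_dominated_convergence[where w="\<lambda>x. norm (f x)"])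
         (use f in \<open>auto intro!: tendsto_intros X simp: norm_mult simp del: of_real_mult\<close>)
  qed
  then show ?thesis by (simp add: continuous_at_imp_continuous_on)
qed

text \<open>Fubini's theorem for the kernel \<open>iexp (c t x)\<close>. Choosing Lebesgue measure for \<open>M\<close> gives the
  multiplication formula, choosing a probability measure and \<open>u = 1\<close> gives Parseval's relation with
  the characteristic function; \<open>c\<close> will be \<open>1\<close> or \<open>- 1\<close>.\<close>

lemma fourier_exchange:
  assumes M: "sigma_finite_measure M" and [measurable_cong]: "sets M = sets borel"
    and u: "integrable M u" and v: "integrable lborel v"
  shows "(LINT x|M. u x * fourier v (c * x)) = (LINT t|lborel. (LINT x|M. u x * iexp (c * t * x)) * v t)"
proof -
  interpret M: sigma_finite_measure M by fact
  interpret P: pair_sigma_finite M lborel ..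
  have [measurable]: "u \<in> borel_measurable borel" "v \<in> borel_measurable borel"
    using u v by (auto simp: measurable_cong_sets[OF \<open>sets M = sets borel\<close> refl] dest!: borel_measurable_integrable)
  let ?f = "\<lambda>x t. u x * (v t * iexp (c * t * x))"
  have "integrable (M \<Otimes>\<^sub>M lborel) (\<lambda>(x, t). ?f x t)"
  proof (rule P.Fubini_integrable)
    show "integrable M (\<lambda>x. LINT y|lborel. norm (case (x, y) of (x, t) \<Rightarrow> ?f x t))"
      using u by (simp add: norm_mult mult_ac)
    show "AE x in M. integrable lborel (\<lambda>y. case (x, y) of (x, t) \<Rightarrow> ?f x t)"
      using v by (auto intro!: AE_I2 integrable_mult_right integrable_times_iexp simp del: of_real_mult)
  qed measurable
  then have "(LINT t|lborel. LINT x|M. ?f x t) = (LINT x|M. LINT t|lborel. ?f x t)"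
    by (rule P.Fubini_integral)
  moreover have "(LINT x|M. ?f x t) = (LINT x|M. u x * iexp (c * t * x)) * v t" for t
    unfolding integral_mult_left_zero[symmetric] by (simp add: mult_ac)
  moreover have "(LINT t|lborel. ?f x t) = u x * fourier v (c * x)" for x
    unfolding fourier_def integral_mult_right_zero by (simp add: mult_ac)
  ultimately show ?thesis by (simp only:)
qed

lemma multiplication_formula:
  assumes u: "integrable lborel u" and v: "integrable lborel v"
  shows "(LINT x|lborel. u x * fourier v (c * x)) = (LINT t|lborel. fourier u (c * t) * v t)"
  using fourier_exchange[OF _ _ u v, of c] by (simp add: fourier_def sigma_finite_lborel)

lemma integral_fourier_char:
  assumes "real_distribution M" and v: "integrable lborel v"
  shows "(LINT x|M. fourier v (c * x)) = (LINT t|lborel. char M (c * t) * v t)"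
proof -
  interpret real_distribution M by fact
  show ?thesis
  using fourier_exchange[of M "\<lambda>_. 1" v c] v
  by (simp add: char_def sigma_finite_measure_axioms)
qed

lemma fourier_modulate:
  "fourier (\<lambda>x. f x * iexp (a * x)) t = fourier f (t + a)"
  unfolding fourier_def by (simp add: distrib_right distrib_left exp_add mult_ac)

lemma fourier_scale:
  assumes "a \<noteq> 0"
  shows "fourier (\<lambda>x. f (a * x)) t = fourier f (t / a) / of_real \<bar>a\<bar>"
  unfolding fourier_def
  using lborel_integral_real_affine[of "1/a" "\<lambda>x. f (a * x) * iexp (t * x)" 0] assms
  by (simp add: scaleR_conv_of_real field_simps of_real_divide del: of_real_mult)

lemma fourier_translate:
  "fourier (\<lambda>x. f (x - a)) t = iexp (t * a) * fourier f t"
proof -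
  have "fourier (\<lambda>x. f (x - a)) t = (LINT x|lborel. f x * iexp (t * (a + x)))"
    unfolding fourier_def
    using lborel_integral_real_affine[of "1" "\<lambda>x. f (x - a) * iexp (t * x)" a]
    by simp
  also have "\<dots> = iexp (t * a) * fourier f t"
    unfolding fourier_def integral_mult_right_zero[symmetric] by (simp add: algebra_simps exp_add)
  finally show ?thesis .
qed

lemma fourier_cnj: "fourier (\<lambda>x. cnj (f x)) t = cnj (fourier f (- t))"
  unfolding fourier_def by (subst Bochner_Integration.integral_cnj[symmetric]) (simp add: exp_cnj del: Bochner_Integration.integral_cnj)

section \<open>Gaussians and Plancherel's theorem\<close>

lemma fourier_std_normal:
  "fourier (\<lambda>x. of_real (std_normal_density x)) t = of_real (sqrt (2 * pi) * std_normal_density t)"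
proof -
  have "fourier (\<lambda>x. of_real (std_normal_density x)) t = char std_normal_distribution t"
    unfolding fourier_def char_def
    by (subst integral_density) (auto simp: scaleR_conv_of_real normal_density_nonneg)
  also have "\<dots> = of_real (sqrt (2 * pi) * std_normal_density t)"
    unfolding char_std_normal_distribution by (simp add: std_normal_density_def field_simps)
  finally show ?thesis .
qed

lemma fourier_gaussian:
  assumes "a > 0"
  shows "fourier (\<lambda>x. of_real (exp (- ((a * x)\<^sup>2 / 2)))) t = of_real (2 * pi / a * std_normal_density (t / a))"
proof -
  have "fourier (\<lambda>x. of_real (exp (- ((a * x)\<^sup>2 / 2)))) t
      = fourier (\<lambda>x. of_real (sqrt (2 * pi)) * of_real (std_normal_density (a * x))) t"
    by (simp add: std_normal_density_def)
  also have "\<dots> = of_real (sqrt (2 * pi)) * fourier (\<lambda>x. of_real (std_normal_density (a * x))) t"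
    unfolding fourier_def integral_mult_right_zero[symmetric] by (simp add: mult_ac)
  also have "\<dots> = of_real (sqrt (2 * pi) * (sqrt (2 * pi) * std_normal_density (t / a) / a))"
    using assms by (simp add: fourier_scale[of a "\<lambda>x. of_real (std_normal_density x)"] fourier_std_normal)
  also have "sqrt (2 * pi) * (sqrt (2 * pi) * std_normal_density (t / a) / a) = 2 * pi / a * std_normal_density (t / a)"
    by (simp add: field_simps)
  finally show ?thesis .
qed

lemma integrable_gaussian:
  assumes "a > 0"
  shows "integrable lborel (\<lambda>x. exp (- ((a * x)\<^sup>2 / 2)) :: real)"
proof -
  have "integrable lborel (\<lambda>x. sqrt (2 * pi) * std_normal_density (0 + a * x))"
    using assms by (intro integrable_mult_right lborel_integrable_real_affine) auto
  then show ?thesis by (simp add: std_normal_density_def)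
qed

text \<open>Applying the multiplication formula twice to \<open>\<bar>h^\<bar>\<^sup>2 = h^ cnj (h^)\<close> moves both transforms onto the
  Gaussian factor, which becomes an approximate identity of width \<open>a\<close>.\<close>

lemma integral_gaussian_fourier_square:
  assumes h: "integrable lborel h" and a: "a > 0"
  shows "complex_of_real (LINT x|lborel. (cmod (fourier h x))\<^sup>2 * exp (- ((a * x)\<^sup>2 / 2)))
    = 2 * pi * (LINT t|lborel. h t * (LINT w|lborel. cnj (h (t - a * w)) * std_normal_density w))"
proof -
  have [measurable]: "h \<in> borel_measurable borel" using h by auto
  define E where "E x = complex_of_real (exp (- ((a * x)\<^sup>2 / 2)))" for x
  have E: "integrable lborel E" unfolding E_def using integrable_gaussian[OF a] by simp
  have [measurable]: "E \<in> borel_measurable borel" using E by auto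
  define v where "v x = cnj (fourier h x) * E x" for x
  have v: "integrable lborel v"
  proof (rule Bochner_Integration.integrable_bound[of lborel "\<lambda>x. (LINT x|lborel. norm (h x)) * E x"])
    show "AE x in lborel. norm (v x) \<le> norm (complex_of_real (LINT x|lborel. norm (h x)) * E x)"
      unfolding v_def norm_mult by (intro AE_I2 mult_right_mono) (auto intro!: order.trans[OF fourier_bound])
  qed (use E in \<open>auto simp: v_def[abs_def]\<close>)
  have fv: "fourier v t = 2 * pi * (LINT w|lborel. cnj (h (t - a * w)) * std_normal_density w)" for t
  proof -
    have "fourier v t = (LINT x|lborel. (E x * iexp (t * x)) * fourier (\<lambda>u. cnj (h u)) (- 1 * x))"
      unfolding fourier_def[of v] v_def by (simp add: fourier_cnj mult_ac)
    also have "\<dots> = (LINT u|lborel. fourier (\<lambda>x. E x * iexp (t * x)) (- 1 * u) * cnj (h u))"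
      by (intro multiplication_formula integrable_times_iexp) (use E h in auto)
    also have "\<dots> = (LINT u|lborel. of_real (2 * pi / a * std_normal_density ((t - u) / a)) * cnj (h u))"
      unfolding fourier_modulate E_def fourier_gaussian[OF a] by simp
    also have "\<dots> = (LINT w|lborel. of_real (2 * pi) * (cnj (h (t - a * w)) * std_normal_density w))"
      using lborel_integral_real_affine[of "-a" "\<lambda>u. of_real (2 * pi / a * std_normal_density ((t - u) / a)) * cnj (h u)" t] a
      unfolding scaleR_conv_of_real integral_mult_right_zero[symmetric] by (simp add: mult_ac)
    finally show ?thesis by simp
  qed
  have "complex_of_real (LINT x|lborel. (cmod (fourier h x))\<^sup>2 * exp (- ((a * x)\<^sup>2 / 2)))
     = (LINT x|lborel. v x * fourier h (1 * x))"
    unfolding integral_complex_of_real[symmetric] v_def E_def of_real_mult complex_norm_square by (simp add: mult_ac)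
  also have "\<dots> = (LINT t|lborel. fourier v (1 * t) * h t)"
    by (rule multiplication_formula[OF v h])
  also have "\<dots> = 2 * pi * (LINT t|lborel. h t * (LINT w|lborel. cnj (h (t - a * w)) * std_normal_density w))"
    unfolding fv integral_mult_right_zero[symmetric] by (simp add: mult_ac)
  finally show ?thesis .
qed

text \<open>Let \<open>a\<close> tend to \<open>0\<close> in \<open>integral_gaussian_fourier_square\<close>. On the left the regularising factor increases to \<open>1\<close>, so
  monotone convergence applies even if the limit is infinite; on the right continuity of \<open>h\<close> at almost
  every point and dominated convergence give \<open>\<integral> \<bar>h\<bar>\<^sup>2\<close>.\<close>

lemma plancherel_bounded:
  assumes h: "integrable lborel h" and bound: "\<And>x. norm (h x) \<le> B"
    and cont: "AE x in lborel. isCont h x"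
  shows "(\<integral>\<^sup>+x. ennreal ((cmod (fourier h x))\<^sup>2) \<partial>lborel) = 2 * pi * (\<integral>\<^sup>+x. ennreal ((cmod (h x))\<^sup>2) \<partial>lborel)"
proof -
  have [measurable]: "h \<in> borel_measurable borel" using h by auto
  define a where "a n = inverse (real (Suc n))" for n
  have a: "a n > 0" for n by (auto simp: a_def)
  have a_lim: "a \<longlonglongrightarrow> 0" unfolding a_def by (rule LIMSEQ_inverse_real_of_nat)
  have B: "B \<ge> 0" using bound[of 0] norm_ge_zero order.trans by blast
  define J where "J n t = (LINT w|lborel. cnj (h (t - a n * w)) * std_normal_density w)" for n t
  have J_meas [measurable]: "J n \<in> borel_measurable borel" for n
    unfolding J_def[abs_def] by measurable
  have G: "integrable lborel std_normal_density" "(LINT w|lborel. std_normal_density w) = 1" by auto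
  have J_bound: "norm (J n t) \<le> B" for n t
  proof -
    have "norm (J n t) \<le> (LINT w|lborel. norm (cnj (h (t - a n * w)) * std_normal_density w))"
      unfolding J_def by (rule integral_norm_bound)
    also have "\<dots> \<le> (LINT w|lborel. B * std_normal_density w)"
      using bound B by (intro integral_mono')
        (auto simp: norm_mult normal_density_nonneg intro!: mult_right_mono)
    finally show ?thesis using G by simp
  qed
  \<comment> \<open>The inner integral averages over \<open>h\<close> near \<open>t\<close>; it converges wherever \<open>h\<close> is continuous.\<close>
  have J_lim: "(\<lambda>n. J n t) \<longlonglongrightarrow> cnj (h t)" if "isCont h t" for t
  proof -
    have "(\<lambda>n. J n t) \<longlonglongrightarrow> (LINT w|lborel. cnj (h t) * std_normal_density w)"
      unfolding J_def
    proof (rule integral_dominated_convergence[where w="\<lambda>w. B * std_normal_density w"])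
      show "AE w in lborel. (\<lambda>n. cnj (h (t - a n * w)) * complex_of_real (std_normal_density w)) \<longlonglongrightarrow> cnj (h t) * std_normal_density w"
      proof (intro AE_I2 tendsto_intros isCont_tendsto_compose[OF that])
        fix w show "(\<lambda>n. t - a n * w) \<longlonglongrightarrow> t"
          by (rule tendsto_eq_rhs[OF tendsto_diff[OF tendsto_const tendsto_mult[OF a_lim tendsto_const]]]) simp
      qed
      show "AE w in lborel. norm (cnj (h (t - a n * w)) * complex_of_real (std_normal_density w)) \<le> B * std_normal_density w" for n
        using bound by (auto simp: norm_mult normal_density_nonneg intro!: mult_right_mono)
    qed auto
    then show ?thesis using G by simp
  qed
  have lim1: "(\<lambda>n. LINT t|lborel. h t * J n t) \<longlonglongrightarrow> (LINT t|lborel. h t * cnj (h t))"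
  proof (rule integral_dominated_convergence[where w="\<lambda>t. B * norm (h t)"])
    show "AE t in lborel. (\<lambda>n. h t * J n t) \<longlonglongrightarrow> h t * cnj (h t)"
      using cont by eventually_elim (auto intro!: tendsto_intros J_lim)
    show "AE t in lborel. norm (h t * J n t) \<le> B * norm (h t)" for n
      unfolding norm_mult by (subst mult.commute) (intro AE_I2 mult_right_mono J_bound norm_ge_zero)
  qed (use h in auto)
  define e where "e n x = (cmod (fourier h x))\<^sup>2 * exp (- ((a n * x)\<^sup>2 / 2))" for n x
  have [measurable]: "e n \<in> borel_measurable borel" for n unfolding e_def[abs_def] by measurable
  have e_int: "integrable lborel (e n)" for n
    unfolding e_def
  proof (rule Bochner_Integration.integrable_bound[of lborel "\<lambda>x. (LINT x|lborel. norm (h x))\<^sup>2 * exp (- ((a n * x)\<^sup>2 / 2))"])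
    show "AE x in lborel. norm ((cmod (fourier h x))\<^sup>2 * exp (- ((a n * x)\<^sup>2 / 2))) \<le> norm ((LINT x|lborel. norm (h x))\<^sup>2 * exp (- ((a n * x)\<^sup>2 / 2)))"
      by (auto simp: abs_mult intro!: AE_I2 mult_right_mono power_mono fourier_bound)
  qed (use integrable_gaussian[OF a] in auto)
  have sq_int: "integrable lborel (\<lambda>t. (cmod (h t))\<^sup>2)"
    by (rule Bochner_Integration.integrable_bound[of lborel "\<lambda>t. B * norm (h t)"])
       (use h bound B in \<open>auto simp: power2_eq_square intro!: mult_right_mono\<close>)
  have "(\<lambda>n. complex_of_real (LINT x|lborel. e n x)) \<longlonglongrightarrow> 2 * pi * (LINT t|lborel. h t * cnj (h t))"
    unfolding e_def integral_gaussian_fourier_square[OF h a] J_def[symmetric]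
    by (intro tendsto_intros lim1)
  also have "2 * pi * (LINT t|lborel. h t * cnj (h t)) = complex_of_real (2 * pi * (LINT t|lborel. (cmod (h t))\<^sup>2))"
    unfolding complex_norm_square[symmetric] integral_complex_of_real by simp
  finally have "(\<lambda>n. (LINT x|lborel. e n x)) \<longlonglongrightarrow> 2 * pi * (LINT t|lborel. (cmod (h t))\<^sup>2)"
    by (simp only: tendsto_of_real_iff)
  then have "(\<lambda>n. ennreal (LINT x|lborel. e n x)) \<longlonglongrightarrow> ennreal (2 * pi * (LINT t|lborel. (cmod (h t))\<^sup>2))"
    by (rule tendsto_ennrealI)
  also have "(\<lambda>n. ennreal (LINT x|lborel. e n x)) = (\<lambda>n. \<integral>\<^sup>+x. ennreal (e n x) \<partial>lborel)"
    by (subst nn_integral_eq_integral[OF e_int]) (auto simp: e_def)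
  also have "ennreal (2 * pi * (LINT t|lborel. (cmod (h t))\<^sup>2)) = 2 * pi * (\<integral>\<^sup>+x. ennreal ((cmod (h x))\<^sup>2) \<partial>lborel)"
    by (subst nn_integral_eq_integral[OF sq_int]) (auto simp: ennreal_mult)
  finally have L1: "(\<lambda>n. \<integral>\<^sup>+x. ennreal (e n x) \<partial>lborel) \<longlonglongrightarrow> 2 * pi * (\<integral>\<^sup>+x. ennreal ((cmod (h x))\<^sup>2) \<partial>lborel)" .
  have L2: "(\<lambda>n. \<integral>\<^sup>+x. ennreal (e n x) \<partial>lborel) \<longlonglongrightarrow> (\<integral>\<^sup>+x. ennreal ((cmod (fourier h x))\<^sup>2) \<partial>lborel)"
  proof (rule nn_integral_LIMSEQ)
    show "incseq (\<lambda>n x. ennreal (e n x))"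
      unfolding incseq_def le_fun_def
    proof (intro allI impI ennreal_leI)
      fix m n :: nat and x :: real assume "m \<le> n"
      then have "a n \<le> a m" unfolding a_def by (intro le_imp_inverse_le) auto
      then have "(a n * x)\<^sup>2 \<le> (a m * x)\<^sup>2"
        unfolding power_mult_distrib using a[of n] by (intro mult_right_mono power_mono) auto
      then show "e m x \<le> e n x" unfolding e_def by (intro mult_left_mono) auto
    qed
    show "(\<lambda>n. ennreal (e n x)) \<longlonglongrightarrow> ennreal ((cmod (fourier h x))\<^sup>2)" for x
    proof -
      have "(\<lambda>n. e n x) \<longlonglongrightarrow> (cmod (fourier h x))\<^sup>2 * exp (- ((0 * x)\<^sup>2 / 2))"
        unfolding e_def by (intro tendsto_intros a_lim) auto
      then show ?thesis by (intro tendsto_ennrealI) simp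
    qed
  qed auto
  show ?thesis by (rule LIMSEQ_unique[OF L2 L1])
qed

section \<open>Injectivity and inversion of the Fourier transform\<close>

text \<open>Reduction to uniqueness of characteristic functions: if the transform of a real \<open>f\<close> vanishes, its
  positive and negative parts have the same mass and, after normalisation, the same characteristic
  function. A complex \<open>f\<close> is split into real and imaginary parts.\<close>

lemma L1_fourier_eq_0_imp_AE:
  assumes f: "integrable lborel f" and F: "\<And>t. fourier f t = 0"
  shows "AE x in lborel. f x = 0"
proof -
  have real_case: "AE x in lborel. r x = 0"
    if r: "integrable lborel r" and R: "\<And>t. fourier (\<lambda>x. of_real (r x)) t = 0" for r :: "real \<Rightarrow> real"
  proof -
    have [measurable]: "r \<in> borel_measurable borel" using r by auto
    define p where "p x = max 0 (r x)" for x
    define n where "n x = max 0 (- r x)" for x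
    have [measurable]: "p \<in> borel_measurable borel" "n \<in> borel_measurable borel"
      unfolding p_def n_def by auto
    have p: "integrable lborel p" and n: "integrable lborel n"
      unfolding p_def n_def using r by auto
    have nonneg: "p x \<ge> 0" "n x \<ge> 0" for x by (auto simp: p_def n_def)
    have r_eq: "r x = p x - n x" for x by (auto simp: p_def n_def)
    have fourier_eq: "fourier (\<lambda>x. of_real (p x)) t = fourier (\<lambda>x. of_real (n x)) t" for t
    proof -
      have "fourier (\<lambda>x. of_real (r x)) t = fourier (\<lambda>x. of_real (p x)) t - fourier (\<lambda>x. of_real (n x)) t"
        unfolding fourier_def using p n
        by (subst Bochner_Integration.integral_diff[symmetric])
           (auto simp: r_eq algebra_simps intro!: integrable_times_iexp simp del: of_real_mult)
      then show ?thesis using R by simp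
    qed
    define c where "c = (LINT x|lborel. p x)"
    have c: "c = (LINT x|lborel. n x)"
      using fourier_eq[of 0] unfolding c_def fourier_def by simp
    show ?thesis
    \<comment> \<open>Normalisation requires positive mass; if the mass is \<open>0\<close>, both parts vanish.\<close>
    proof (cases "c = 0")
      case True
      then have "AE x in lborel. p x = 0" "AE x in lborel. n x = 0"
        using integral_nonneg_eq_0_iff_AE[OF p] integral_nonneg_eq_0_iff_AE[OF n] nonneg c c_def by auto
      then show ?thesis by eventually_elim (simp add: r_eq)
    next
      case False
      then have "c > 0" using Bochner_Integration.integral_nonneg[of lborel p] nonneg unfolding c_def by (simp add: less_le)
      define P where "P q = density lborel (\<lambda>x. ennreal (q x / c))" for q :: "real \<Rightarrow> real"
      have dist: "real_distribution (P q)"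
        if q: "integrable lborel q" "\<And>x. q x \<ge> 0" "c = (LINT x|lborel. q x)" for q
      proof -
        have [measurable]: "q \<in> borel_measurable borel" using q by auto
        have "emeasure (P q) (space (P q)) = (\<integral>\<^sup>+x. ennreal (q x / c) \<partial>lborel)"
          unfolding P_def by (subst emeasure_density) auto
        also have "\<dots> = ennreal (LINT x|lborel. q x / c)"
          using q \<open>c > 0\<close> by (subst nn_integral_eq_integral) auto
        also have "(LINT x|lborel. q x / c) = 1" using q(3) \<open>c > 0\<close> by simp
        finally show ?thesis unfolding real_distribution_def real_distribution_axioms_def
          by (auto simp: P_def intro!: prob_spaceI)
      qed
      have char: "char (P q) t = fourier (\<lambda>x. of_real (q x)) t / of_real c"
        if q: "integrable lborel q" "\<And>x. q x \<ge> 0" for q t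
      proof -
        have [measurable]: "q \<in> borel_measurable borel" using q by auto
        have "char (P q) t = (LINT x|lborel. (of_real (q x) * iexp (t * x)) / of_real c)"
          unfolding P_def char_def using \<open>c > 0\<close> q(2)
          by (subst integral_density) (auto simp: scaleR_conv_of_real)
        also have "\<dots> = fourier (\<lambda>x. of_real (q x)) t / of_real c"
          unfolding fourier_def by (rule integral_divide_zero)
        finally show ?thesis .
      qed
      have "P p = P n"
        by (intro Levy_uniqueness dist ext) (use p n nonneg c c_def fourier_eq in \<open>auto simp: char\<close>)
      then have "AE x in lborel. ennreal (p x / c) = ennreal (n x / c)"
        unfolding P_def by (subst (asm) sigma_finite_measure.density_unique_iff[OF sigma_finite_lborel]) auto
      then show ?thesis
        by eventually_elim (use \<open>c > 0\<close> nonneg in \<open>auto simp: r_eq divide_simps\<close>)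
    qed
  qed
  have conj: "fourier (\<lambda>x. cnj (f x)) t = 0" for t using F by (simp add: fourier_cnj)
  have fc: "integrable lborel (\<lambda>x. cnj (f x))" using f by simp
  have int: "integrable lborel (\<lambda>x. f x * iexp (t * x))"
    "integrable lborel (\<lambda>x. cnj (f x) * iexp (t * x))" for t
    using f fc by (auto intro!: integrable_times_iexp simp del: of_real_mult)
  have "fourier (\<lambda>x. of_real (Re (f x))) t = (fourier f t + fourier (\<lambda>x. cnj (f x)) t) / 2" for t
    unfolding fourier_def Bochner_Integration.integral_add[OF int, symmetric]
      distrib_right[symmetric] complex_add_cnj integral_divide_zero[symmetric] by simp
  then have 1: "fourier (\<lambda>x. of_real (Re (f x))) t = 0" for t
    using F conj by simp
  have Im_eq: "(f x - cnj (f x)) * e / (2 * \<i>) = of_real (Im (f x)) * e" for x e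
    unfolding complex_diff_cnj by (simp add: field_simps)
  have "fourier (\<lambda>x. of_real (Im (f x))) t = (fourier f t - fourier (\<lambda>x. cnj (f x)) t) / (2 * \<i>)" for t
    unfolding fourier_def Bochner_Integration.integral_diff[OF int, symmetric]
      left_diff_distrib[symmetric] integral_divide_zero[symmetric] Im_eq ..
  then have 2: "fourier (\<lambda>x. of_real (Im (f x))) t = 0" for t
    using F conj by simp
  have "AE x in lborel. Re (f x) = 0" "AE x in lborel. Im (f x) = 0"
    using f by (auto intro!: real_case 1 2)
  then show ?thesis by eventually_elim (simp add: complex_eq_iff)
qed

lemma Cauchy_Schwarz_integral:
  fixes u v :: "'a \<Rightarrow> complex"
  assumes [measurable]: "u \<in> borel_measurable M" "v \<in> borel_measurable M"
  shows "ennreal ((norm (LINT x|M. u x * v x))\<^sup>2)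
    \<le> (\<integral>\<^sup>+x. ennreal ((norm (u x))\<^sup>2) \<partial>M) * (\<integral>\<^sup>+x. ennreal ((norm (v x))\<^sup>2) \<partial>M)"
proof -
  have "ennreal (norm (LINT x|M. u x * v x)) \<le> (\<integral>\<^sup>+x. ennreal (norm (u x)) * ennreal (norm (v x)) \<partial>M)"
  proof (cases "integrable M (\<lambda>x. u x * v x)")
    case True
    from integral_norm_bound_ennreal[OF this] show ?thesis by (simp add: norm_mult ennreal_mult)
  qed (simp add: not_integrable_integral_eq)
  then have "(ennreal (norm (LINT x|M. u x * v x)))\<^sup>2 \<le> (\<integral>\<^sup>+x. ennreal (norm (u x)) * ennreal (norm (v x)) \<partial>M)\<^sup>2"
    by (intro power_mono) auto
  also note Cauchy_Schwarz_nn_integral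
  finally show ?thesis by (simp add: ennreal_power)
qed

lemma truncated_fourier_integral:
  "(LINT x:{-R..R}|lborel. f x * exp (- (\<i> * complex_of_real t * complex_of_real x)))
    = fourier (\<lambda>x. indicator {-R..R} x *\<^sub>R f x) (- 1 * t)"
  unfolding fourier_def set_lebesgue_integral_def by (simp add: mult_ac)

lemma square_integrable_imp_integrable_truncation:
  assumes "square_integrable f"
  shows "integrable lborel (\<lambda>x. indicator {-R..R} x *\<^sub>R f x)"
proof (rule Bochner_Integration.integrable_bound[of lborel "\<lambda>x. (cmod (f x))\<^sup>2 + indicator {-R..R::real} x"])
  show "integrable lborel (\<lambda>x. (cmod (f x))\<^sup>2 + indicator {-R..R::real} x :: real)"
    using assms by (intro Bochner_Integration.integrable_add) (auto simp: square_integrable_def integrable_real_indicator emeasure_lborel_Icc_eq)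
  have "a \<le> a\<^sup>2 + 1" for a :: real using zero_le_power2[of "a - 1/2"] by (simp add: power2_eq_square algebra_simps)
  then show "AE x in lborel. norm (indicator {-R..R} x *\<^sub>R f x) \<le> norm ((cmod (f x))\<^sup>2 + indicator {-R..R} x :: real)"
    by (auto split: split_indicator)
  have [measurable]: "f \<in> borel_measurable borel" using assms by (simp add: square_integrable_def)
  show "(\<lambda>x. indicator {-R..R} x *\<^sub>R f x) \<in> borel_measurable lborel" by measurable
qed

text \<open>Two limits in \<open>L\<^sup>2\<close> of the same truncated integrals agree. This makes the choice in
  \<^const>\<open>fourier_L2\<close> harmless.\<close>

lemma has_fourier_L2_unique:
  assumes g: "has_fourier_L2 f g" and g': "has_fourier_L2 f g'"
  shows "AE t in lborel. g t = g' t"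
proof -
  have [measurable]: "f \<in> borel_measurable borel" "g \<in> borel_measurable borel" "g' \<in> borel_measurable borel"
    using g g' by (auto simp: has_fourier_L2_def square_integrable_def)
  define F where "F R t = (LINT x:{-R..R}|lborel. f x * exp (- (\<i> * complex_of_real t * complex_of_real x)))" for R t
  have [measurable]: "F R \<in> borel_measurable borel" for R
    unfolding F_def[abs_def] truncated_fourier_integral by measurable
  have lim: "((\<lambda>R. \<integral>\<^sup>+t. ennreal ((cmod (g t - F R t))\<^sup>2) \<partial>lborel) \<longlongrightarrow> 0) at_top"
    "((\<lambda>R. \<integral>\<^sup>+t. ennreal ((cmod (g' t - F R t))\<^sup>2) \<partial>lborel) \<longlongrightarrow> 0) at_top"
    using g g' by (auto simp: has_fourier_L2_def F_def)
  have "((\<lambda>R. 2 * (\<integral>\<^sup>+t. ennreal ((cmod (g t - F R t))\<^sup>2) \<partial>lborel)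
       + 2 * (\<integral>\<^sup>+t. ennreal ((cmod (g' t - F R t))\<^sup>2) \<partial>lborel)) \<longlongrightarrow> 2 * 0 + 2 * 0) at_top"
    by (intro tendsto_add ennreal_tendsto_cmult lim) auto
  moreover have "(\<integral>\<^sup>+t. ennreal ((cmod (g t - g' t))\<^sup>2) \<partial>lborel)
     \<le> 2 * (\<integral>\<^sup>+t. ennreal ((cmod (g t - F R t))\<^sup>2) \<partial>lborel)
       + 2 * (\<integral>\<^sup>+t. ennreal ((cmod (g' t - F R t))\<^sup>2) \<partial>lborel)" for R
  proof -
    have "(cmod (g t - g' t))\<^sup>2 \<le> 2 * (cmod (g t - F R t))\<^sup>2 + 2 * (cmod (g' t - F R t))\<^sup>2" for t
    proof -
      have "cmod (g t - g' t) \<le> cmod (g t - F R t) + cmod (g' t - F R t)"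
        using norm_triangle_ineq4[of "g t - F R t" "g' t - F R t"] by simp
      then have "(cmod (g t - g' t))\<^sup>2 \<le> (cmod (g t - F R t) + cmod (g' t - F R t))\<^sup>2"
        by (intro power_mono) auto
      also have "\<dots> \<le> 2 * (cmod (g t - F R t))\<^sup>2 + 2 * (cmod (g' t - F R t))\<^sup>2"
        using zero_le_power2[of "cmod (g t - F R t) - cmod (g' t - F R t)"]
        by (simp add: power2_eq_square algebra_simps)
      finally show ?thesis .
    qed
    then have "(\<integral>\<^sup>+t. ennreal ((cmod (g t - g' t))\<^sup>2) \<partial>lborel)
      \<le> (\<integral>\<^sup>+t. 2 * ennreal ((cmod (g t - F R t))\<^sup>2) + 2 * ennreal ((cmod (g' t - F R t))\<^sup>2) \<partial>lborel)"
      by (intro nn_integral_mono) (simp add: ennreal_mult'[symmetric] ennreal_plus[symmetric] ennreal_leI flip: ennreal_numeral del: ennreal_plus)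
    then show ?thesis by (simp add: nn_integral_add nn_integral_cmult)
  qed
  ultimately have "(\<integral>\<^sup>+t. ennreal ((cmod (g t - g' t))\<^sup>2) \<partial>lborel) \<le> 2 * 0 + 2 * 0"
    by (intro tendsto_lowerbound[where F="at_top::real filter"]) auto
  then have "(\<integral>\<^sup>+t. ennreal ((cmod (g t - g' t))\<^sup>2) \<partial>lborel) = 0"
    by simp
  then have "AE t in lborel. ennreal ((cmod (g t - g' t))\<^sup>2) = 0"
    by (subst (asm) nn_integral_0_iff_AE) auto
  then show ?thesis by eventually_elim (simp add: ennreal_eq_0_iff)
qed

text \<open>The function \<open>\<Phi> = fourier g / (2 \<pi>)\<close> is given by an ordinary integral, but \<open>f\<close> need not be
  integrable. Multiplying \<open>f\<close> and \<open>\<Phi>\<close> by a Gaussian makes them integrable, so by injectivity it suffices to compare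
  \<open>\<integral> f K\<close> and \<open>\<integral> \<Phi> K\<close> for all modulated Gaussians \<open>K\<close>. Each \<open>K\<close> is, up to a constant, the transform of a
  translated Gaussian \<open>k\<close>, and the multiplication formula turns both integrals into \<open>\<integral> g k\<close>, for \<open>f\<close>
  through the limit of its truncations.\<close>

lemma fourier_inversion_L2:
  assumes fg: "has_fourier_L2 f g" and gi: "integrable lborel g"
  shows "AE x in lborel. f x = fourier g x / (2 * pi)"
proof -
  have f2: "square_integrable f" and g2: "square_integrable g"
    using fg by (auto simp: has_fourier_L2_def)
  have [measurable]: "f \<in> borel_measurable borel" "g \<in> borel_measurable borel"
    using f2 g2 by (auto simp: square_integrable_def)
  define G where "G x = complex_of_real (std_normal_density x)" for x
  have [measurable]: "G \<in> borel_measurable borel" unfolding G_def[abs_def] by measurable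
  have G_int: "integrable lborel G" unfolding G_def by simp
  \<comment> \<open>The bound gives \<open>\<bar>f G\<bar> \<le> \<bar>f\<bar>\<^sup>2 + G\<close>, so that \<open>f G\<close> is integrable.\<close>
  have G_le: "norm (G x) \<le> 1" for x
  proof -
    have "1 * exp (- x\<^sup>2 / 2) \<le> sqrt (2 * pi) * 1"
      using pi_ge_two by (intro mult_mono) auto
    then have "std_normal_density x \<le> 1"
      by (simp add: std_normal_density_def divide_simps)
    then show ?thesis
      unfolding G_def norm_of_real by (simp add: normal_density_nonneg)
  qed
  have fG: "integrable lborel (\<lambda>x. f x * G x)"
  proof (rule Bochner_Integration.integrable_bound[of lborel "\<lambda>x. (cmod (f x))\<^sup>2 + cmod (G x)"])
    show "integrable lborel (\<lambda>x. (cmod (f x))\<^sup>2 + cmod (G x))"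
      using f2 G_int by (auto simp: square_integrable_def)
    have "a * b \<le> a\<^sup>2 + b" if "b \<ge> 0" "b \<le> 1" "a \<ge> 0" for a b :: real
    proof -
      have "a * b \<le> (a\<^sup>2 + 1) * b" using zero_le_power2[of "a - 1/2"] that
        by (intro mult_right_mono) (simp_all add: power2_eq_square algebra_simps)
      also have "\<dots> \<le> a\<^sup>2 + b" using mult_left_mono[of b 1 "a\<^sup>2"] that by (simp add: algebra_simps)
      finally show ?thesis .
    qed
    then show "AE x in lborel. norm (f x * G x) \<le> norm ((cmod (f x))\<^sup>2 + cmod (G x))"
      using G_le by (auto simp: norm_mult)
  qed measurable
  define \<Phi> where "\<Phi> x = fourier g x / (2 * pi)" for x
  have [measurable]: "\<Phi> \<in> borel_measurable borel" unfolding \<Phi>_def[abs_def] by measurable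
  have PG: "integrable lborel (\<lambda>x. \<Phi> x * G x)"
  proof (rule Bochner_Integration.integrable_bound[of lborel "\<lambda>x. ((LINT x|lborel. norm (g x)) / (2 * pi)) * G x"])
    show "AE x in lborel. norm (\<Phi> x * G x) \<le> norm (complex_of_real ((LINT x|lborel. norm (g x)) / (2 * pi)) * G x)"
      unfolding \<Phi>_def norm_mult
      by (intro AE_I2 mult_right_mono) (auto simp: norm_divide intro!: divide_right_mono fourier_bound)
  qed (use G_int in auto)
  have same: "fourier (\<lambda>x. f x * G x) \<xi> = fourier (\<lambda>x. \<Phi> x * G x) \<xi>" for \<xi>
  proof -
    define k where "k t = G (t + \<xi>)" for t
    have k_int: "integrable lborel k" unfolding k_def[abs_def]
      using lborel_integrable_real_affine[OF G_int, of 1 \<xi>] by (simp add: add.commute)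
    have [measurable]: "k \<in> borel_measurable borel" using k_int by auto
    have fk: "fourier k (- 1 * x) = sqrt (2 * pi) * (G x * iexp (\<xi> * x))" for x
      using fourier_translate[of G "- \<xi>" "- x"] fourier_std_normal[of "- x"]
      by (simp add: k_def[abs_def] G_def[abs_def] std_normal_density_def mult_ac)
    define F where "F n t = fourier (\<lambda>x. indicator {-real n..real n} x *\<^sub>R f x) (- 1 * t)" for n t
    have [measurable]: "F n \<in> borel_measurable borel" for n unfolding F_def[abs_def] by measurable
    have F_lim: "(\<lambda>n. \<integral>\<^sup>+t. ennreal ((cmod (g t - F n t))\<^sup>2) \<partial>lborel) \<longlonglongrightarrow> 0"
      using fg filterlim_compose[OF _ filterlim_real_sequentially]
      by (auto simp: has_fourier_L2_def truncated_fourier_integral F_def)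
    have Fk_int: "integrable lborel (\<lambda>t. F n t * k t)" for n
    proof (rule Bochner_Integration.integrable_bound[of lborel "\<lambda>t. (LINT x|lborel. norm (indicator {-real n..real n} x *\<^sub>R f x)) * k t"])
      show "AE t in lborel. norm (F n t * k t) \<le> norm (complex_of_real (LINT x|lborel. norm (indicator {-real n..real n} x *\<^sub>R f x)) * k t)"
        unfolding norm_mult F_def by (intro AE_I2 mult_right_mono order.trans[OF fourier_bound]) auto
    qed (use k_int in auto)
    have gk_int: "integrable lborel (\<lambda>t. g t * k t)"
      by (rule Bochner_Integration.integrable_bound[OF gi])
         (use G_le in \<open>auto simp: norm_mult k_def intro!: mult_left_le\<close>)
    have 1: "(\<lambda>n. LINT t|lborel. F n t * k t) \<longlonglongrightarrow> (LINT t|lborel. g t * k t)"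
    proof -
      \<comment> \<open>Convergence of the truncated transforms in \<open>L\<^sup>2\<close> implies convergence tested against \<open>k\<close>.\<close>
      define C where "C = (\<integral>\<^sup>+t. ennreal ((norm (k t))\<^sup>2) \<partial>lborel)"
      have "C \<le> (\<integral>\<^sup>+t. ennreal (norm (k t)) \<partial>lborel)"
        unfolding C_def using G_le by (intro nn_integral_mono ennreal_leI) (auto simp: power2_eq_square k_def intro!: mult_left_le)
      also have "\<dots> < \<infinity>" using k_int by (simp add: integrable_iff_bounded)
      finally have C: "C < \<infinity>" .
      have b: "ennreal ((norm ((LINT t|lborel. g t * k t) - (LINT t|lborel. F n t * k t)))\<^sup>2)
         \<le> (\<integral>\<^sup>+t. ennreal ((cmod (g t - F n t))\<^sup>2) \<partial>lborel) * C" for n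
        unfolding C_def
        using Cauchy_Schwarz_integral[of "\<lambda>t. g t - F n t" lborel k]
        by (simp add: Bochner_Integration.integral_diff[OF gk_int Fk_int] left_diff_distrib)
      have L: "(\<lambda>n. (\<integral>\<^sup>+t. ennreal ((cmod (g t - F n t))\<^sup>2) \<partial>lborel) * C) \<longlonglongrightarrow> ennreal 0"
        using ennreal_tendsto_cmult[OF _ F_lim, of C] C by (simp add: mult.commute)
      have "(\<lambda>n. ennreal ((norm ((LINT t|lborel. g t * k t) - (LINT t|lborel. F n t * k t)))\<^sup>2)) \<longlonglongrightarrow> ennreal 0"
        by (rule tendsto_sandwich[OF _ _ tendsto_const L]) (use b in auto)
      then have "(\<lambda>n. ((norm ((LINT t|lborel. g t * k t) - (LINT t|lborel. F n t * k t)))\<^sup>2)) \<longlonglongrightarrow> 0"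
        by (subst (asm) tendsto_ennreal_iff) auto
      then have "(\<lambda>n. norm ((LINT t|lborel. g t * k t) - (LINT t|lborel. F n t * k t))) \<longlonglongrightarrow> 0"
        by (drule_tac tendsto_real_sqrt) simp
      then have "(\<lambda>n. (LINT t|lborel. g t * k t) - (LINT t|lborel. F n t * k t)) \<longlonglongrightarrow> 0"
        by (simp add: tendsto_norm_zero_iff)
      from tendsto_diff[OF tendsto_const[of "LINT t|lborel. g t * k t"] this] show ?thesis by simp
    qed
    have "(\<lambda>n. LINT x|lborel. indicator {-real n..real n} x *\<^sub>R (f x * fourier k (- 1 * x)))
        \<longlonglongrightarrow> (LINT x|lborel. f x * fourier k (- 1 * x))"
    proof (rule integral_dominated_convergence[where w="\<lambda>x. sqrt (2 * pi) * norm (f x * G x)"])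
      have "(\<lambda>n. indicator {-real n..real n} x *\<^sub>R (f x * fourier k (- 1 * x))) \<longlonglongrightarrow> f x * fourier k (- 1 * x)" for x
      proof (rule tendsto_eventually)
        show "\<forall>\<^sub>F n in sequentially. indicator {-real n..real n} x *\<^sub>R (f x * fourier k (- 1 * x)) = f x * fourier k (- 1 * x)"
          using eventually_ge_at_top[of "nat \<lceil>\<bar>x\<bar>\<rceil>"]
          by eventually_elim (auto split: split_indicator simp: nat_le_iff ceiling_le_iff)
      qed
      then show "AE x in lborel. (\<lambda>n. indicator {-real n..real n} x *\<^sub>R (f x * fourier k (- 1 * x))) \<longlonglongrightarrow> f x * fourier k (- 1 * x)"
        by simp
      show "integrable lborel (\<lambda>x. sqrt (2 * pi) * norm (f x * G x))"
        using integrable_norm[OF fG] by (rule integrable_mult_right)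
      have "norm (f x * fourier k (- 1 * x)) = sqrt (2 * pi) * norm (f x * G x)" for x
        unfolding fk norm_mult norm_of_real norm_exp_i_times by simp
      then show "AE x in lborel. norm (indicator {-real n..real n} x *\<^sub>R (f x * fourier k (- 1 * x)))
          \<le> sqrt (2 * pi) * norm (f x * G x)" for n
        by (auto split: split_indicator)
    qed measurable
    also have "(LINT x|lborel. f x * fourier k (- 1 * x)) = sqrt (2 * pi) * fourier (\<lambda>x. f x * G x) \<xi>"
      unfolding fk fourier_def[of "\<lambda>x. f x * G x"] integral_mult_right_zero[symmetric] by (simp add: mult_ac)
    also have "(\<lambda>n. LINT x|lborel. indicator {-real n..real n} x *\<^sub>R (f x * fourier k (- 1 * x))) = (\<lambda>n. LINT t|lborel. F n t * k t)"
      unfolding F_def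
      using multiplication_formula[OF square_integrable_imp_integrable_truncation[OF f2] k_int, of "real _" "-1"]
      by simp
    finally have eq1: "sqrt (2 * pi) * fourier (\<lambda>x. f x * G x) \<xi> = (LINT t|lborel. g t * k t)"
      using 1 LIMSEQ_unique by blast
    have K_int: "integrable lborel (\<lambda>x. G x * iexp (\<xi> * x))"
      using G_int by (intro integrable_times_iexp) auto
    have fK: "fourier (\<lambda>x. G x * iexp (\<xi> * x)) t = sqrt (2 * pi) * k t" for t
      unfolding fourier_modulate k_def using fourier_std_normal[of "t + \<xi>"] by (simp add: G_def[abs_def])
    have "2 * pi * fourier (\<lambda>x. \<Phi> x * G x) \<xi> = (LINT x|lborel. (G x * iexp (\<xi> * x)) * fourier g (1 * x))"
      unfolding fourier_def[of "\<lambda>x. \<Phi> x * G x"] unfolding \<Phi>_def integral_mult_right_zero[symmetric] by (simp add: mult_ac)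
    also have "\<dots> = (LINT t|lborel. sqrt (2 * pi) * k t * g t)"
      using multiplication_formula[OF K_int gi, of 1] by (simp only: mult_1 fK)
    also have "\<dots> = sqrt (2 * pi) * (LINT t|lborel. g t * k t)"
      unfolding integral_mult_right_zero[symmetric] by (simp add: mult_ac)
    also have "\<dots> = (complex_of_real (sqrt (2 * pi)) * complex_of_real (sqrt (2 * pi))) * fourier (\<lambda>x. f x * G x) \<xi>"
      unfolding eq1[symmetric] by (simp only: mult.assoc)
    also have "complex_of_real (sqrt (2 * pi)) * complex_of_real (sqrt (2 * pi)) = complex_of_real (2 * pi)"
      unfolding of_real_mult[symmetric] by simp
    finally show ?thesis by simp
  qed
  have "fourier (\<lambda>x. f x * G x - \<Phi> x * G x) \<xi> = 0" for \<xi>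
  proof -
    have "fourier (\<lambda>x. f x * G x - \<Phi> x * G x) \<xi> = fourier (\<lambda>x. f x * G x) \<xi> - fourier (\<lambda>x. \<Phi> x * G x) \<xi>"
      unfolding fourier_def left_diff_distrib
      by (intro Bochner_Integration.integral_diff integrable_times_iexp fG PG) auto
    then show ?thesis using same by simp
  qed
  then have "AE x in lborel. f x * G x - \<Phi> x * G x = 0"
    by (intro L1_fourier_eq_0_imp_AE Bochner_Integration.integrable_diff fG PG)
  then show ?thesis
  proof eventually_elim
    case (elim x)
    then have "(f x - \<Phi> x) * G x = 0" by (simp only: left_diff_distrib)
    moreover have "G x \<noteq> 0" by (simp add: G_def std_normal_density_def)
    ultimately show ?case by (simp add: \<Phi>_def)
  qed
qed

section \<open>Sobolev functions and their continuous representatives\<close>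

lemma nn_integral_even:
  fixes f :: "real \<Rightarrow> ennreal"
  assumes [measurable]: "f \<in> borel_measurable borel" and even: "\<And>t. f (- t) = f t"
  shows "(\<integral>\<^sup>+t. f t \<partial>lborel) = 2 * (\<integral>\<^sup>+t\<in>{0<..}. f t \<partial>lborel)"
proof -
  have "(\<integral>\<^sup>+t. f t \<partial>lborel) = (\<integral>\<^sup>+t. f t * indicator {0<..} t + f t * indicator {..<0} t \<partial>lborel)"
    by (intro nn_integral_cong_AE, use AE_lborel_singleton[of 0] in eventually_elim)
       (auto split: split_indicator)
  also have "\<dots> = (\<integral>\<^sup>+t\<in>{0<..}. f t \<partial>lborel) + (\<integral>\<^sup>+t\<in>{..<0}. f t \<partial>lborel)"
    by (intro nn_integral_add) auto
  also have "(\<integral>\<^sup>+t\<in>{..<0}. f t \<partial>lborel) = (\<integral>\<^sup>+t\<in>{0<..}. f t \<partial>lborel)"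
    by (subst nn_integral_real_affine[where c="-1" and t=0])
       (auto simp: even intro!: nn_integral_cong split: split_indicator)
  finally show ?thesis by (simp add: mult_2)
qed

text \<open>The condition \<open>s > 1/2\<close> is exactly what makes this weight integrable; it renders transforms of
  Sobolev functions integrable and the weighted energy of the characteristic functions finite.\<close>

lemma nn_integral_weight_finite:
  fixes s :: real
  assumes s: "s > 1 / 2"
  shows "(\<integral>\<^sup>+t. ennreal ((1 + 2 * \<bar>t\<bar>) powr (- (2 * s))) \<partial>lborel) < \<infinity>"
proof -
  define k where "k = 2 * s - 1"
  have "k > 0" using s by (simp add: k_def)
  have even: "(\<integral>\<^sup>+t. ennreal ((1 + 2 * \<bar>t\<bar>) powr (- (2 * s))) \<partial>lborel)
      = 2 * (\<integral>\<^sup>+t\<in>{0<..}. ennreal ((1 + 2 * \<bar>t\<bar>) powr (- (2 * s))) \<partial>lborel)"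
    by (rule nn_integral_even) auto
  have "(\<integral>\<^sup>+t\<in>{0<..}. ennreal ((1 + 2 * \<bar>t\<bar>) powr (- (2 * s))) \<partial>lborel)
      \<le> (\<integral>\<^sup>+t\<in>{0..}. ennreal ((1 + 2 * t) powr (- (2 * s))) \<partial>lborel)"
    by (intro nn_integral_mono) (auto split: split_indicator)
  also have "\<dots> = ennreal (0 - (- ((1 + 2 * 0) powr (- k) / (2 * k))))"
  proof (rule nn_integral_FTC_atLeast)
    show "((\<lambda>t. - ((1 + 2 * t) powr (- k) / (2 * k))) \<longlongrightarrow> 0) at_top"
    proof -
      have "filterlim (\<lambda>t::real. 1 + 2 * t) at_top at_top"
        by (intro filterlim_tendsto_add_at_top[OF tendsto_const] filterlim_tendsto_pos_mult_at_top[OF tendsto_const _ filterlim_ident]) auto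
      then have "((\<lambda>t. (1 + 2 * t) powr (- k)) \<longlongrightarrow> 0) at_top"
        using \<open>k > 0\<close> by (intro tendsto_neg_powr) auto
      from tendsto_minus[OF tendsto_divide_zero[OF this]] show ?thesis by simp
    qed
    show "((\<lambda>t. - ((1 + 2 * t) powr (- k) / (2 * k))) has_real_derivative (1 + 2 * t) powr (- (2 * s))) (at t)"
      if "0 \<le> t" for t
    proof -
      have e: "- (2 * s) = - k - 1" by (simp add: k_def)
      show ?thesis unfolding e
        using that \<open>k > 0\<close> by (auto intro!: derivative_eq_intros simp: powr_diff)
    qed
  qed auto
  also have "\<dots> < \<infinity>" by simp
  finally show ?thesis unfolding even by (simp add: ennreal_mult_less_top)
qed

lemma continuous_AE_eq_imp_eq:
  fixes f g :: "real \<Rightarrow> complex"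
  assumes f: "continuous_on UNIV f" and g: "continuous_on UNIV g" and eq: "AE x in lborel. f x = g x"
  shows "f = g"
proof -
  have "open {x. f x \<noteq> g x}" by (intro open_Collect_neq f g)
  moreover have "{x. f x \<noteq> g x} \<in> null_sets lborel"
    using eq \<open>open {x. f x \<noteq> g x}\<close> by (subst AE_iff_null_sets) (auto simp: borel_open)
  then have "negligible {x. f x \<noteq> g x}"
    by (simp add: negligible_iff_null_sets null_sets_completionI)
  ultimately have "{x. f x \<noteq> g x} = {}" using open_not_negligible by blast
  then show ?thesis by auto
qed

lemma continuous_rep_eq:
  assumes "continuous_on UNIV g" "bounded (range g)" "AE x in lborel. g x = f x"
  shows "continuous_rep f = g"
  unfolding continuous_rep_def
proof (rule the_equality)
  fix h assume h: "continuous_on UNIV h \<and> bounded (range h) \<and> (AE x in lborel. h x = f x)"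
  with assms(3) have "AE x in lborel. h x = g x" by auto
  then show "h = g" using h assms(1) by (intro continuous_AE_eq_imp_eq) auto
qed (use assms in auto)

text \<open>The definition of the Sobolev space speaks of some \<open>L\<^sup>2\<close> transform; uniqueness almost everywhere
  transfers finiteness of the weighted integral to the chosen one. Integrability then follows from the
  Cauchy-Schwarz inequality against the integrable weight.\<close>

lemma sobolev_fourier_L2:
  assumes f: "f \<in> sobolev s" and s: "s > 1 / 2"
  shows "has_fourier_L2 f (fourier_L2 f)" "integrable lborel (fourier_L2 f)"
    "ennreal ((sobolev_norm s f)\<^sup>2) = (\<integral>\<^sup>+t. ennreal ((1 + 2 * \<bar>t\<bar>) powr (2 * s) * (cmod (fourier_L2 f t))\<^sup>2) \<partial>lborel)"
proof -
  from f obtain g where g: "has_fourier_L2 f g"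
    and fin: "(\<integral>\<^sup>+t. ennreal ((1 + 2 * \<bar>t\<bar>) powr (2 * s) * (cmod (g t))\<^sup>2) \<partial>lborel) < \<infinity>"
    unfolding sobolev_def by auto
  show g': "has_fourier_L2 f (fourier_L2 f)"
    unfolding fourier_L2_def by (rule someI[of "has_fourier_L2 f", OF g])
  let ?w = "\<lambda>t. (1 + 2 * \<bar>t\<bar>) powr (2 * s) * (cmod (fourier_L2 f t))\<^sup>2"
  have [measurable]: "fourier_L2 f \<in> borel_measurable borel"
    using g' by (simp add: has_fourier_L2_def square_integrable_def)
  have eq: "AE t in lborel. g t = fourier_L2 f t" by (rule has_fourier_L2_unique[OF g g'])
  have "(\<integral>\<^sup>+t. ennreal (?w t) \<partial>lborel) = (\<integral>\<^sup>+t. ennreal ((1 + 2 * \<bar>t\<bar>) powr (2 * s) * (cmod (g t))\<^sup>2) \<partial>lborel)"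
    by (intro nn_integral_cong_AE) (use eq in eventually_elim, simp)
  with fin have fin': "(\<integral>\<^sup>+t. ennreal (?w t) \<partial>lborel) < \<infinity>" by simp
  then have w_int: "integrable lborel ?w"
    by (subst integrable_iff_bounded) (auto simp: abs_mult)
  show norm_eq: "ennreal ((sobolev_norm s f)\<^sup>2) = (\<integral>\<^sup>+t. ennreal (?w t) \<partial>lborel)"
    unfolding sobolev_norm_def
    by (subst nn_integral_eq_integral[OF w_int]) (auto intro!: Bochner_Integration.integral_nonneg)
  have "(\<integral>\<^sup>+t. ennreal (norm (fourier_L2 f t)) \<partial>lborel)\<^sup>2
    = (\<integral>\<^sup>+t. ennreal ((1 + 2 * \<bar>t\<bar>) powr (- s)) * ennreal ((1 + 2 * \<bar>t\<bar>) powr s * norm (fourier_L2 f t)) \<partial>lborel)\<^sup>2"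
    by (intro arg_cong[where f="\<lambda>x. x\<^sup>2"] nn_integral_cong)
       (simp add: ennreal_mult[symmetric] mult.assoc[symmetric] powr_add[symmetric])
  also have "\<dots> \<le> (\<integral>\<^sup>+t. (ennreal ((1 + 2 * \<bar>t\<bar>) powr (- s)))\<^sup>2 \<partial>lborel)
      * (\<integral>\<^sup>+t. (ennreal ((1 + 2 * \<bar>t\<bar>) powr s * norm (fourier_L2 f t)))\<^sup>2 \<partial>lborel)"
    by (rule Cauchy_Schwarz_nn_integral) auto
  also have "\<dots> = (\<integral>\<^sup>+t. ennreal ((1 + 2 * \<bar>t\<bar>) powr (- (2 * s))) \<partial>lborel) * (\<integral>\<^sup>+t. ennreal (?w t) \<partial>lborel)"
    by (simp add: ennreal_power power_mult_distrib powr_power mult.commute)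
  also have "\<dots> < \<infinity>" using nn_integral_weight_finite[OF s] fin' by (simp add: ennreal_mult_less_top)
  finally have "(\<integral>\<^sup>+t. ennreal (norm (fourier_L2 f t)) \<partial>lborel) < \<infinity>"
    by (simp add: power_less_top_ennreal)
  then show "integrable lborel (fourier_L2 f)"
    by (subst integrable_iff_bounded) auto
qed

lemma continuous_rep_sobolev:
  assumes f: "f \<in> sobolev s" and s: "s > 1 / 2"
  shows "continuous_rep f = (\<lambda>x. fourier (fourier_L2 f) x / (2 * pi))" (is "_ = ?\<Phi>")
    and "continuous_on UNIV (continuous_rep f)" and "bounded (range (continuous_rep f))"
proof -
  note g = sobolev_fourier_L2[OF f s]
  have c: "continuous_on UNIV ?\<Phi>"
    by (intro continuous_intros fourier_continuous g) auto
  have b: "bounded (range ?\<Phi>)"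
    by (rule boundedI[of _ "(LINT x|lborel. norm (fourier_L2 f x)) / (2 * pi)"])
       (auto simp: norm_divide intro!: divide_right_mono fourier_bound)
  show "continuous_rep f = ?\<Phi>"
    by (intro continuous_rep_eq c b) (use fourier_inversion_L2[OF g(1,2)] in eventually_elim, simp)
  then show "continuous_on UNIV (continuous_rep f)" "bounded (range (continuous_rep f))"
    using c b by simp_all
qed

section \<open>Resolvents and the Sobolev inequality for two distributions\<close>

text \<open>Euler's integral for \<open>Gamma p\<close> after the substitution \<open>t = a y\<close>.\<close>

lemma nn_integral_exp_powr:
  fixes a p :: real
  assumes a: "a > 0" and p: "p > 0"
  shows "(\<integral>\<^sup>+y\<in>{0<..}. ennreal (exp (- a * y) * y powr (p - 1)) \<partial>lborel) = ennreal (Gamma p / a powr p)"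
proof -
  let ?J = "\<integral>\<^sup>+y\<in>{0<..}. ennreal (exp (- a * y) * y powr (p - 1)) \<partial>lborel"
  have "ennreal (Gamma p) = \<bar>a\<bar> * (\<integral>\<^sup>+y. ennreal (indicator {0..} (0 + a * y) * (0 + a * y) powr (p - 1) / exp (0 + a * y)) \<partial>lborel)"
    unfolding Gamma_conv_nn_integral_real[OF p] using a by (intro nn_integral_real_affine) auto
  also have "(\<integral>\<^sup>+y. ennreal (indicator {0..} (0 + a * y) * (0 + a * y) powr (p - 1) / exp (0 + a * y)) \<partial>lborel)
     = (\<integral>\<^sup>+y. ennreal (a powr (p - 1)) * (ennreal (exp (- a * y) * y powr (p - 1)) * indicator {0<..} y) \<partial>lborel)"
    using a by (intro nn_integral_cong)
      (auto simp: powr_mult exp_minus field_simps zero_le_mult_iff ennreal_mult[symmetric] split: split_indicator)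
  also have "\<dots> = ennreal (a powr (p - 1)) * ?J" by (rule nn_integral_cmult) auto
  also have "ennreal \<bar>a\<bar> * (ennreal (a powr (p - 1)) * ?J) = ennreal (a powr p) * ?J"
    using a by (simp add: mult.assoc[symmetric] ennreal_mult[symmetric] powr_diff)
  finally have "ennreal (1 / a powr p) * ennreal (Gamma p) = ennreal (1 / a powr p) * (ennreal (a powr p) * ?J)"
    by simp
  then show ?thesis using a Gamma_real_pos[OF p]
    by (simp add: mult.assoc[symmetric] ennreal_mult[symmetric])
qed

text \<open>The bias is defined through \<^const>\<open>continuous_rep\<close>, which has to be evaluated also at the functions
  that define \<open>\<beta>\<close>.\<close>

lemma continuous_rep_resolvent:
  assumes z: "Im z \<noteq> 0"
  defines "r \<equiv> \<lambda>x. 1 / (z - complex_of_real x)"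
  shows "continuous_rep r = r" and "continuous_on UNIV r" and "bounded (range r)"
proof -
  have nz: "z - complex_of_real x \<noteq> 0" for x using z by (auto simp: complex_eq_iff)
  show c: "continuous_on UNIV r" unfolding r_def by (intro continuous_intros) (use nz in auto)
  show b: "bounded (range r)"
  proof (rule boundedI[of _ "1 / \<bar>Im z\<bar>"])
    fix y assume "y \<in> range r"
    then obtain x where "y = r x" by auto
    moreover have "\<bar>Im z\<bar> \<le> cmod (z - complex_of_real x)"
      using abs_Im_le_cmod[of "z - complex_of_real x"] by simp
    ultimately show "norm y \<le> 1 / \<bar>Im z\<bar>"
      using z by (auto simp: r_def norm_divide intro!: divide_left_mono mult_pos_pos)
  qed
  show "continuous_rep r = r" by (intro continuous_rep_eq c b) auto
qed

text \<open>Integrating \<open>exp (- c t)\<close> with \<open>c = y - \<i> u\<close> over the half line gives \<open>1 / c = \<i> / (u + \<i> y)\<close>; this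
  represents the resolvent as a superposition of characters.\<close>

lemma fourier_one_sided_exponential:
  assumes y: "y > 0"
  shows "integrable lborel (\<lambda>t. indicator {0<..} t * complex_of_real (exp (- y * t)))"
    and "fourier (\<lambda>t. indicator {0<..} t * complex_of_real (exp (- y * t))) u = \<i> / Complex u y"
proof -
  define e where "e t = indicator {0<..} t * complex_of_real (exp (- y * t))" for t
  show e_int: "integrable lborel (\<lambda>t. indicator {0<..} t * complex_of_real (exp (- y * t)))"
    unfolding integrable_iff_bounded
  proof
    have "(\<integral>\<^sup>+t. ennreal (norm (indicator {0<..} t * complex_of_real (exp (- y * t)))) \<partial>lborel)
      = (\<integral>\<^sup>+t\<in>{0<..}. ennreal (exp (- y * t) * t powr (1 - 1)) \<partial>lborel)"
      by (intro nn_integral_cong) (auto split: split_indicator)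
    also have "\<dots> < \<infinity>" by (subst nn_integral_exp_powr) (use y in auto)
    finally show "(\<integral>\<^sup>+t. ennreal (norm (indicator {0<..} t * complex_of_real (exp (- y * t)))) \<partial>lborel) < \<infinity>" .
  qed measurable
  define c where "c = y - \<i> * complex_of_real u"
  have c: "c \<noteq> 0" using y by (auto simp: c_def complex_eq_iff)
  have eq: "exp (- c * complex_of_real t) = complex_of_real (exp (- y * t)) * iexp (u * t)" for t
    unfolding c_def exp_of_real[symmetric] exp_add[symmetric] by (simp add: algebra_simps)
  have "(LBINT t=0..\<infinity>. exp (- c * complex_of_real t)) = 0 - (- (1 / c))"
  proof (rule interval_integral_FTC_integrable[where F="\<lambda>t. - (exp (- c * complex_of_real t) / c)"])
    show "((\<lambda>t. - (exp (- c * complex_of_real t) / c)) has_vector_derivative exp (- c * complex_of_real x)) (at x)" for x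
      using c by (auto intro!: derivative_eq_intros has_vector_derivative_real_field)
    show "set_integrable lborel (einterval 0 \<infinity>) (\<lambda>t. exp (- c * complex_of_real t))"
      unfolding set_integrable_def zero_ereal_def einterval_eq
      using integrable_times_iexp[OF e_int, of "\<lambda>t. u * t"]
      by (rule Bochner_Integration.integrable_cong[THEN iffD1, rotated 2])
         (auto simp: eq[unfolded mult_minus_left] split: split_indicator simp del: of_real_mult)
    show "(((\<lambda>t. - (exp (- c * complex_of_real t) / c)) \<circ> real_of_ereal) \<longlongrightarrow> - (1 / c)) (at_right 0)"
    proof -
      have "isCont (\<lambda>t. - (exp (- c * complex_of_real t) / c)) 0" using c by (intro continuous_intros) auto
      then have "((\<lambda>t. - (exp (- c * complex_of_real t) / c)) \<longlongrightarrow> - (1 / c)) (at_right 0)"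
        by (auto simp: isCont_def intro: filterlim_mono[OF _ order_refl at_le])
      then show ?thesis unfolding zero_ereal_def ereal_tendsto_simps .
    qed
    show "(((\<lambda>t. - (exp (- c * complex_of_real t) / c)) \<circ> real_of_ereal) \<longlongrightarrow> 0) (at_left \<infinity>)"
      unfolding ereal_tendsto_simps
    proof (rule tendsto_norm_zero_cancel)
      have "filterlim (\<lambda>t. - y * t) at_bot at_top"
        using y by (intro filterlim_tendsto_neg_mult_at_bot[OF tendsto_const _ filterlim_ident]) auto
      then have "((\<lambda>t. exp (- y * t) / norm c) \<longlongrightarrow> 0) at_top"
        by (intro tendsto_divide_zero filterlim_compose[OF exp_at_bot])
      then show "((\<lambda>t. norm (- (exp (- c * complex_of_real t) / c))) \<longlongrightarrow> 0) at_top"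
        unfolding norm_minus_cancel norm_divide eq norm_mult norm_exp_i_times norm_of_real by simp
    qed
  qed auto
  also have "(LBINT t=0..\<infinity>. exp (- c * complex_of_real t)) = fourier e u"
    unfolding interval_lebesgue_integral_0_infty set_lebesgue_integral_def fourier_def
    by (intro Bochner_Integration.integral_cong) (auto simp: eq[unfolded mult_minus_left] e_def split: split_indicator simp del: of_real_mult)
  also have "0 - (- (1 / c)) = \<i> / Complex u y"
    using c y by (simp add: c_def divide_simps) (auto simp: complex_eq_iff)
  finally show "fourier (\<lambda>t. indicator {0<..} t * complex_of_real (exp (- y * t))) u = \<i> / Complex u y"
    unfolding e_def .
qed

lemma integral_resolvent_eq_fourier:
  assumes "real_distribution M" and y: "y > 0"
  shows "(LINT l|M. 1 / (Complex x y - complex_of_real l))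
    = - \<i> * fourier (\<lambda>t. indicator {0<..} t * complex_of_real (exp (- y * t)) * char M (- t)) x"
proof -
  define e where "e t = indicator {0<..} t * complex_of_real (exp (- y * t))" for t
  note e = fourier_one_sided_exponential[OF y, folded e_def]
  have "1 / (Complex x y - complex_of_real l) = - \<i> * fourier (\<lambda>t. e t * iexp (x * t)) (- 1 * l)" for l
    unfolding fourier_modulate e by (simp add: Complex_eq algebra_simps)
  then have "(LINT l|M. 1 / (Complex x y - complex_of_real l)) = - \<i> * (LINT l|M. fourier (\<lambda>t. e t * iexp (x * t)) (- 1 * l))"
    by (simp only: integral_mult_right_zero)
  also have "(LINT l|M. fourier (\<lambda>t. e t * iexp (x * t)) (- 1 * l)) = (LINT t|lborel. char M (- 1 * t) * (e t * iexp (x * t)))"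
    by (intro integral_fourier_char assms integrable_times_iexp e) auto
  finally show ?thesis unfolding fourier_def e_def by (simp add: mult_ac)
qed

text \<open>Fourier inversion turns the difference of the two integrals of \<open>f\<close> into an integral of its transform
  against the difference of the characteristic functions; the weight is then distributed over the
  two factors before applying the Cauchy-Schwarz inequality.\<close>

lemma sobolev_duality:
  fixes c :: real
  assumes eta: "real_distribution \<eta>" and rho: "real_distribution \<rho>"
    and f: "f \<in> sobolev s" and s: "s > 1 / 2"
  shows "ennreal ((2 * pi * cmod (c * ((LINT x|\<eta>. continuous_rep f x) - (LINT x|\<rho>. continuous_rep f x))))\<^sup>2)
    \<le> (\<integral>\<^sup>+t. ennreal ((1 + 2 * \<bar>t\<bar>) powr (- (2 * s)) * (cmod (c * (char \<eta> t - char \<rho> t)))\<^sup>2) \<partial>lborel)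
       * ennreal ((sobolev_norm s f)\<^sup>2)"
proof -
  interpret eta: real_distribution \<eta> by fact
  interpret rho: real_distribution \<rho> by fact
  define g where "g = fourier_L2 f"
  note g = sobolev_fourier_L2[OF f s, folded g_def]
  have [measurable]: "g \<in> borel_measurable borel" using g(2) by auto
  define \<psi> where "\<psi> t = c * (char \<eta> t - char \<rho> t)" for t
  have [measurable]: "\<psi> \<in> borel_measurable borel" unfolding \<psi>_def[abs_def] by measurable
  have rep: "(LINT x|M. continuous_rep f x) = (LINT t|lborel. char M t * g t) / (2 * pi)"
    if "real_distribution M" for M
    unfolding continuous_rep_sobolev(1)[OF f s, folded g_def] integral_divide_zero
    using integral_fourier_char[OF that g(2), of 1] by simp
  have int: "integrable lborel (\<lambda>t. char M t * g t)" if "real_distribution M" for M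
  proof -
    interpret M: real_distribution M by fact
    show ?thesis
      by (rule Bochner_Integration.integrable_bound[OF g(2)])
         (auto simp: norm_mult M.cmod_char_le_1 intro!: mult_left_le_one_le)
  qed
  let ?L = "c * ((LINT x|\<eta>. continuous_rep f x) - (LINT x|\<rho>. continuous_rep f x))"
  have "2 * pi * ?L = c * ((LINT t|lborel. char \<eta> t * g t) - (LINT t|lborel. char \<rho> t * g t))"
    unfolding rep[OF eta] rep[OF rho] by (simp add: diff_divide_distrib[symmetric])
  also have "\<dots> = (LINT t|lborel. \<psi> t * g t)"
    unfolding Bochner_Integration.integral_diff[OF int[OF eta] int[OF rho], symmetric] integral_mult_right_zero[symmetric]
    by (simp add: \<psi>_def algebra_simps)
  also have "\<dots> = (LINT t|lborel. (complex_of_real ((1 + 2 * \<bar>t\<bar>) powr (- s)) * \<psi> t) * (complex_of_real ((1 + 2 * \<bar>t\<bar>) powr s) * g t))"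
  proof (rule Bochner_Integration.integral_cong)
    fix t :: real
    have "(1 + 2 * \<bar>t\<bar>) powr (- s) * (1 + 2 * \<bar>t\<bar>) powr s = 1" by (simp flip: powr_add)
    then have "complex_of_real ((1 + 2 * \<bar>t\<bar>) powr (- s)) * complex_of_real ((1 + 2 * \<bar>t\<bar>) powr s) = 1"
      by (simp flip: of_real_mult)
    then have "\<psi> t * g t = (complex_of_real ((1 + 2 * \<bar>t\<bar>) powr (- s)) * complex_of_real ((1 + 2 * \<bar>t\<bar>) powr s)) * (\<psi> t * g t)"
      by simp
    then show "\<psi> t * g t = (complex_of_real ((1 + 2 * \<bar>t\<bar>) powr (- s)) * \<psi> t) * (complex_of_real ((1 + 2 * \<bar>t\<bar>) powr s) * g t)"
      by (simp only: mult_ac)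
  qed auto
  finally have L: "2 * pi * ?L = (LINT t|lborel. (complex_of_real ((1 + 2 * \<bar>t\<bar>) powr (- s)) * \<psi> t) * (complex_of_real ((1 + 2 * \<bar>t\<bar>) powr s) * g t))" .
  have "ennreal ((2 * pi * cmod ?L)\<^sup>2) = ennreal ((cmod (2 * pi * ?L))\<^sup>2)"
    by (simp add: norm_mult)
  also have "\<dots> \<le> (\<integral>\<^sup>+t. ennreal ((norm (complex_of_real ((1 + 2 * \<bar>t\<bar>) powr (- s)) * \<psi> t))\<^sup>2) \<partial>lborel)
      * (\<integral>\<^sup>+t. ennreal ((norm (complex_of_real ((1 + 2 * \<bar>t\<bar>) powr s) * g t))\<^sup>2) \<partial>lborel)"
    unfolding L by (rule Cauchy_Schwarz_integral) measurable
  also have "\<dots> = (\<integral>\<^sup>+t. ennreal ((1 + 2 * \<bar>t\<bar>) powr (- (2 * s)) * (cmod (\<psi> t))\<^sup>2) \<partial>lborel)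
      * (\<integral>\<^sup>+t. ennreal ((1 + 2 * \<bar>t\<bar>) powr (2 * s) * (cmod (g t))\<^sup>2) \<partial>lborel)"
    by (simp add: norm_mult power_mult_distrib powr_power mult.commute)
  finally show ?thesis unfolding g(3)[symmetric] \<psi>_def .
qed

lemma cmod_scaled_char_diff_le:
  fixes c :: real
  assumes eta: "real_distribution \<eta>" and rho: "real_distribution \<rho>"
  shows "cmod (c * (char \<eta> t - char \<rho> t)) \<le> 2 * \<bar>c\<bar>"
proof -
  interpret eta: real_distribution \<eta> by fact
  interpret rho: real_distribution \<rho> by fact
  have "cmod (char \<eta> t - char \<rho> t) \<le> 2"
    using norm_triangle_ineq4[of "char \<eta> t" "char \<rho> t"]
      eta.cmod_char_le_1[of t] rho.cmod_char_le_1[of t] by linarith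
  then show ?thesis unfolding norm_mult by (simp add: mult.commute mult_left_mono)
qed

text \<open>Write \<open>\<psi> = c (char \<eta> - char \<rho>)\<close>. For fixed \<open>y\<close> the inner integral is the squared \<open>L\<^sup>2\<close> norm of the one-sided function
  \<open>exp (- y t) \<psi> (- t)\<close>, up to the factor \<open>2 \<pi>\<close>. Interchanging the integrals over \<open>y\<close> and \<open>t\<close>, the
  factors \<open>exp (- y)\<close> and \<open>exp (- 2 t y)\<close> combine to \<open>exp (- (1 + 2 t) y)\<close>, which explains the weight
  \<open>1 + 2 \<bar>t\<bar>\<close> of the Sobolev norm. Symmetry of \<open>\<bar>\<psi>\<bar>\<close> makes the integral over the half line one half of
  that over the whole line.\<close>

lemma resolvent_energy:
  fixes c :: real
  assumes eta: "real_distribution \<eta>" and rho: "real_distribution \<rho>" and p: "p > 0"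
  defines "\<beta> \<equiv> \<lambda>z. c * ((LINT l|\<eta>. 1 / (z - complex_of_real l)) - (LINT l|\<rho>. 1 / (z - complex_of_real l)))"
  shows "(\<integral>\<^sup>+y\<in>{0<..}. ennreal (exp (- y) * y powr (p - 1)) * (\<integral>\<^sup>+x. ennreal ((cmod (\<beta> (Complex x y)))\<^sup>2) \<partial>lborel) \<partial>lborel)
    = ennreal (pi * Gamma p) * (\<integral>\<^sup>+t. ennreal ((1 + 2 * \<bar>t\<bar>) powr (- p) * (cmod (c * (char \<eta> t - char \<rho> t)))\<^sup>2) \<partial>lborel)"
proof -
  interpret eta: real_distribution \<eta> by fact
  interpret rho: real_distribution \<rho> by fact
  define \<psi> where "\<psi> t = c * (char \<eta> t - char \<rho> t)" for t
  have [measurable]: "\<psi> \<in> borel_measurable borel" unfolding \<psi>_def[abs_def] by measurable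
  have char_minus: "char M (- t) = cnj (char M t)" for M t
    unfolding char_def Bochner_Integration.integral_cnj[symmetric] by (simp add: exp_cnj del: Bochner_Integration.integral_cnj)
  have psi_minus: "cmod (\<psi> (- t)) = cmod (\<psi> t)" for t
  proof -
    have "\<psi> (- t) = cnj (\<psi> t)" unfolding \<psi>_def char_minus by simp
    then show ?thesis by simp
  qed
  have psi_bound: "cmod (\<psi> t) \<le> 2 * \<bar>c\<bar>" for t
    unfolding \<psi>_def by (rule cmod_scaled_char_diff_le[OF eta rho])
  have psi_cont: "isCont \<psi> t" for t
    unfolding \<psi>_def[abs_def] by (intro continuous_intros eta.isCont_char rho.isCont_char)
  define h where "h y t = indicator {0<..} t * complex_of_real (exp (- y * t)) * \<psi> (- t)" for y t
  have char_int: "integrable lborel (\<lambda>t. indicator {0<..} t * complex_of_real (exp (- y * t)) * v t)"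
    if "y > 0" "v \<in> borel_measurable borel" "\<And>t. cmod (v t) \<le> B" for y B v
  proof (rule Bochner_Integration.integrable_bound)
    show "integrable lborel (\<lambda>t. complex_of_real B * (indicator {0<..} t * complex_of_real (exp (- y * t))))"
      using fourier_one_sided_exponential(1)[OF that(1)] by (rule integrable_mult_right)
    have "B \<ge> 0" using that(3)[of 0] norm_ge_zero order.trans by blast
    then show "AE t in lborel. norm (indicator {0<..} t * complex_of_real (exp (- y * t)) * v t)
        \<le> norm (complex_of_real B * (indicator {0<..} t * complex_of_real (exp (- y * t))))"
      using that(3) by (intro AE_I2) (auto simp: norm_mult mult.commute intro!: mult_right_mono split: split_indicator)
  qed (use that(2) in measurable)
  have h_int: "integrable lborel (h y)" if "y > 0" for y
    unfolding h_def using psi_bound that by (intro char_int) auto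
  have beta_eq: "\<beta> (Complex x y) = - \<i> * fourier (h y) x" if y: "y > 0" for x y
  proof -
    let ?k = "\<lambda>M t. indicator {0<..} t * complex_of_real (exp (- y * t)) * char M (- t)"
    have int: "integrable lborel (\<lambda>t. ?k \<eta> t * iexp (x * t))" "integrable lborel (\<lambda>t. ?k \<rho> t * iexp (x * t))"
      by (intro integrable_times_iexp char_int[OF y, of _ 1] eta.cmod_char_le_1 rho.cmod_char_le_1; measurable)+
    have "\<beta> (Complex x y) = - \<i> * (c * (fourier (?k \<eta>) x - fourier (?k \<rho>) x))"
      unfolding \<beta>_def integral_resolvent_eq_fourier[OF eta y] integral_resolvent_eq_fourier[OF rho y]
      by (simp add: algebra_simps)
    also have "c * (fourier (?k \<eta>) x - fourier (?k \<rho>) x) = fourier (h y) x"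
      unfolding fourier_def Bochner_Integration.integral_diff[OF int, symmetric] integral_mult_right_zero[symmetric]
      by (intro Bochner_Integration.integral_cong refl) (simp add: h_def \<psi>_def algebra_simps)
    finally show ?thesis .
  qed
  have plancherel: "(\<integral>\<^sup>+x. ennreal ((cmod (\<beta> (Complex x y)))\<^sup>2) \<partial>lborel)
      = ennreal (2 * pi) * (\<integral>\<^sup>+t\<in>{0<..}. ennreal (exp (- (2 * t) * y) * (cmod (\<psi> t))\<^sup>2) \<partial>lborel)"
    if y: "y > 0" for y
  proof -
    have "(\<integral>\<^sup>+x. ennreal ((cmod (\<beta> (Complex x y)))\<^sup>2) \<partial>lborel) = (\<integral>\<^sup>+x. ennreal ((cmod (fourier (h y) x))\<^sup>2) \<partial>lborel)"
      unfolding beta_eq[OF y] norm_mult by simp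
    also have "\<dots> = ennreal (2 * pi) * (\<integral>\<^sup>+t. ennreal ((cmod (h y t))\<^sup>2) \<partial>lborel)"
    proof (rule plancherel_bounded[OF h_int[OF y]])
      show "norm (h y t) \<le> 2 * \<bar>c\<bar>" for t
      proof -
        have "norm (h y t) \<le> 1 * cmod (\<psi> (- t))"
          unfolding h_def norm_mult using y by (intro mult_right_mono) (auto split: split_indicator)
        then show ?thesis using psi_bound[of "- t"] by simp
      qed
      have cont1: "continuous_on {0<..} (h y)"
      proof (rule continuous_on_eq)
        show "continuous_on {0<..} (\<lambda>t. complex_of_real (exp (- y * t)) * \<psi> (- t))"
        proof (intro continuous_at_imp_continuous_on ballI isCont_mult)
          fix t show "isCont (\<lambda>t. \<psi> (- t)) t"
            by (rule isCont_o2[OF _ psi_cont]) (intro continuous_intros)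
        qed (intro continuous_intros)
      qed (auto simp: h_def)
      have cont2: "continuous_on {..<0} (h y)"
        by (rule continuous_on_eq[where f="\<lambda>_. 0"]) (auto simp: h_def)
      \<comment> \<open>The cut at \<open>0\<close> is the only possible discontinuity.\<close>
      have h_cont: "isCont (h y) t" if "t \<noteq> 0" for t
        using that cont1 cont2 by (cases "t > 0") (auto simp: continuous_on_eq_continuous_at)
      show "AE t in lborel. isCont (h y) t"
        by (rule eventually_mono[OF AE_lborel_singleton[of 0]]) (rule h_cont)
    qed
    also have "(\<integral>\<^sup>+t. ennreal ((cmod (h y t))\<^sup>2) \<partial>lborel) = (\<integral>\<^sup>+t\<in>{0<..}. ennreal (exp (- (2 * t) * y) * (cmod (\<psi> t))\<^sup>2) \<partial>lborel)"
      by (intro nn_integral_cong)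
         (auto simp: h_def norm_mult power_mult_distrib psi_minus power2_eq_square exp_add[symmetric] split: split_indicator)
    finally show ?thesis .
  qed
  have "(\<integral>\<^sup>+y\<in>{0<..}. ennreal (exp (- y) * y powr (p - 1)) * (\<integral>\<^sup>+x. ennreal ((cmod (\<beta> (Complex x y)))\<^sup>2) \<partial>lborel) \<partial>lborel)
    = (\<integral>\<^sup>+y. \<integral>\<^sup>+t. ennreal (2 * pi) * (ennreal ((cmod (\<psi> t))\<^sup>2) * indicator {0<..} t
         * (ennreal (exp (- (1 + 2 * t) * y) * y powr (p - 1)) * indicator {0<..} y)) \<partial>lborel \<partial>lborel)"
  proof (rule nn_integral_cong)
    fix y :: real
    show "ennreal (exp (- y) * y powr (p - 1)) * (\<integral>\<^sup>+x. ennreal ((cmod (\<beta> (Complex x y)))\<^sup>2) \<partial>lborel) * indicator {0<..} y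
      = (\<integral>\<^sup>+t. ennreal (2 * pi) * (ennreal ((cmod (\<psi> t))\<^sup>2) * indicator {0<..} t
         * (ennreal (exp (- (1 + 2 * t) * y) * y powr (p - 1)) * indicator {0<..} y)) \<partial>lborel)"
    proof (cases "y > 0")
      case True
      have "ennreal (exp (- y) * y powr (p - 1)) * (ennreal (2 * pi) * (\<integral>\<^sup>+t\<in>{0<..}. ennreal (exp (- (2 * t) * y) * (cmod (\<psi> t))\<^sup>2) \<partial>lborel))
        = (\<integral>\<^sup>+t. ennreal (exp (- y) * y powr (p - 1)) * (ennreal (2 * pi) * (ennreal (exp (- (2 * t) * y) * (cmod (\<psi> t))\<^sup>2) * indicator {0<..} t)) \<partial>lborel)"
        by (simp add: nn_integral_cmult)
      also have "\<dots> = (\<integral>\<^sup>+t. ennreal (2 * pi) * (ennreal ((cmod (\<psi> t))\<^sup>2) * indicator {0<..} t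
         * (ennreal (exp (- (1 + 2 * t) * y) * y powr (p - 1)))) \<partial>lborel)"
      proof (rule nn_integral_cong)
        fix t :: real
        have "exp (- (1 + 2 * t) * y) = exp (- y) * exp (- (2 * t) * y)"
          unfolding exp_add[symmetric] by (simp add: algebra_simps)
        then show "ennreal (exp (- y) * y powr (p - 1)) * (ennreal (2 * pi) * (ennreal (exp (- (2 * t) * y) * (cmod (\<psi> t))\<^sup>2) * indicator {0<..} t))
          = ennreal (2 * pi) * (ennreal ((cmod (\<psi> t))\<^sup>2) * indicator {0<..} t * (ennreal (exp (- (1 + 2 * t) * y) * y powr (p - 1))))"
          by (simp add: ennreal_mult mult_ac)
      qed
      finally show ?thesis using True plancherel[OF True] by simp
    qed simp
  qed
  also have "\<dots> = (\<integral>\<^sup>+t. \<integral>\<^sup>+y. ennreal (2 * pi) * (ennreal ((cmod (\<psi> t))\<^sup>2) * indicator {0<..} t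
         * (ennreal (exp (- (1 + 2 * t) * y) * y powr (p - 1)) * indicator {0<..} y)) \<partial>lborel \<partial>lborel)"
    by (rule lborel_pair.Fubini') measurable
  also have "\<dots> = (\<integral>\<^sup>+t. ennreal (2 * pi * Gamma p) * (ennreal ((1 + 2 * \<bar>t\<bar>) powr (- p) * (cmod (\<psi> t))\<^sup>2) * indicator {0<..} t) \<partial>lborel)"
  proof (rule nn_integral_cong)
    fix t :: real
    show "(\<integral>\<^sup>+y. ennreal (2 * pi) * (ennreal ((cmod (\<psi> t))\<^sup>2) * indicator {0<..} t
         * (ennreal (exp (- (1 + 2 * t) * y) * y powr (p - 1)) * indicator {0<..} y)) \<partial>lborel)
       = ennreal (2 * pi * Gamma p) * (ennreal ((1 + 2 * \<bar>t\<bar>) powr (- p) * (cmod (\<psi> t))\<^sup>2) * indicator {0<..} t)"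
    proof (cases "t > 0")
      case True
      then have "(\<integral>\<^sup>+y. ennreal (2 * pi) * (ennreal ((cmod (\<psi> t))\<^sup>2) * indicator {0<..} t
         * (ennreal (exp (- (1 + 2 * t) * y) * y powr (p - 1)) * indicator {0<..} y)) \<partial>lborel)
         = ennreal (2 * pi) * (ennreal ((cmod (\<psi> t))\<^sup>2) * (\<integral>\<^sup>+y\<in>{0<..}. ennreal (exp (- (1 + 2 * t) * y) * y powr (p - 1)) \<partial>lborel))"
        by (simp add: nn_integral_cmult)
      also have "\<dots> = ennreal (2 * pi) * (ennreal ((cmod (\<psi> t))\<^sup>2) * ennreal (Gamma p / (1 + 2 * t) powr p))"
        using True p by (subst nn_integral_exp_powr) auto
      also have "\<dots> = ennreal (2 * pi * Gamma p) * ennreal ((1 + 2 * \<bar>t\<bar>) powr (- p) * (cmod (\<psi> t))\<^sup>2)"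
        using True Gamma_real_pos[OF p] by (simp add: ennreal_mult[symmetric] powr_minus field_simps)
      finally show ?thesis using True by simp
    qed simp
  qed
  also have "\<dots> = ennreal (2 * pi * Gamma p) * (\<integral>\<^sup>+t\<in>{0<..}. ennreal ((1 + 2 * \<bar>t\<bar>) powr (- p) * (cmod (\<psi> t))\<^sup>2) \<partial>lborel)"
    by (rule nn_integral_cmult) auto
  also have "\<dots> = ennreal (pi * Gamma p) * (\<integral>\<^sup>+t. ennreal ((1 + 2 * \<bar>t\<bar>) powr (- p) * (cmod (\<psi> t))\<^sup>2) \<partial>lborel)"
    using Gamma_real_pos[OF p]
    by (subst nn_integral_even) (auto simp: psi_minus ennreal_mult mult_ac)
  finally show ?thesis unfolding \<psi>_def .
qed

text \<open>With \<open>A\<close> the weighted integral common to \<open>sobolev_duality\<close> and \<open>resolvent_energy\<close>, duality gives \<open>2 \<pi> \<bar>L f\<bar> \<le> sqrt A \<parallel>f\<parallel>\<close> and the right-hand side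
  contains \<open>sqrt (\<pi> Gamma (2 s) A)\<close>. Since \<open>\<psi>\<close> is bounded, \<open>A\<close> is finite and can be eliminated.\<close>

lemma sobolev_resolvent_inequality:
  fixes c :: real
  assumes eta: "real_distribution \<eta>" and rho: "real_distribution \<rho>"
    and f: "f \<in> sobolev s" and s: "s > 1 / 2"
  defines "L \<equiv> \<lambda>\<phi>. c * ((LINT x|\<eta>. continuous_rep \<phi> x) - (LINT x|\<rho>. continuous_rep \<phi> x))"
  shows "ennreal (cmod (L f))
    \<le> ennreal (sobolev_norm s f / (2 * pi powr (3 / 2) * Gamma (2 * s) powr (1 / 2)))
      * ennreal_sqrt (\<integral>\<^sup>+y\<in>{0<..}. ennreal (exp (- y) * y powr (2 * s - 1))
          * (\<integral>\<^sup>+x. ennreal ((cmod (L (\<lambda>l. 1 / (Complex x y - complex_of_real l))))\<^sup>2) \<partial>lborel) \<partial>lborel)"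
proof -
  define \<psi> where "\<psi> t = c * (char \<eta> t - char \<rho> t)" for t
  define A where "A = (\<integral>\<^sup>+t. ennreal ((1 + 2 * \<bar>t\<bar>) powr (- (2 * s)) * (cmod (\<psi> t))\<^sup>2) \<partial>lborel)"
  have G: "Gamma (2 * s) > 0" using s by (intro Gamma_real_pos) auto
  have S: "sobolev_norm s f \<ge> 0"
    unfolding sobolev_norm_def by (auto intro!: Bochner_Integration.integral_nonneg)
  have "A \<le> (\<integral>\<^sup>+t. ennreal ((2 * \<bar>c\<bar>)\<^sup>2) * ennreal ((1 + 2 * \<bar>t\<bar>) powr (- (2 * s))) \<partial>lborel)"
    unfolding A_def
  proof (intro nn_integral_mono)
    fix t :: real
    have "cmod (\<psi> t) \<le> 2 * \<bar>c\<bar>"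
      unfolding \<psi>_def by (rule cmod_scaled_char_diff_le[OF eta rho])
    then have "(cmod (\<psi> t))\<^sup>2 \<le> (2 * \<bar>c\<bar>)\<^sup>2" by (intro power_mono) auto
    then show "ennreal ((1 + 2 * \<bar>t\<bar>) powr (- (2 * s)) * (cmod (\<psi> t))\<^sup>2) \<le> ennreal ((2 * \<bar>c\<bar>)\<^sup>2) * ennreal ((1 + 2 * \<bar>t\<bar>) powr (- (2 * s)))"
      by (subst ennreal_mult[symmetric], simp, simp, intro ennreal_leI, subst mult.commute)
         (intro mult_right_mono, auto)
  qed
  also have "\<dots> = ennreal ((2 * \<bar>c\<bar>)\<^sup>2) * (\<integral>\<^sup>+t. ennreal ((1 + 2 * \<bar>t\<bar>) powr (- (2 * s))) \<partial>lborel)"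
    by (rule nn_integral_cmult) auto
  also have "\<dots> < \<infinity>" using nn_integral_weight_finite[OF s] by (simp add: ennreal_mult_less_top)
  finally obtain a where a: "a \<ge> 0" "A = ennreal a" by (cases A) auto
  have "(\<integral>\<^sup>+y\<in>{0<..}. ennreal (exp (- y) * y powr (2 * s - 1))
          * (\<integral>\<^sup>+x. ennreal ((cmod (L (\<lambda>l. 1 / (Complex x y - complex_of_real l))))\<^sup>2) \<partial>lborel) \<partial>lborel)
     = (\<integral>\<^sup>+y\<in>{0<..}. ennreal (exp (- y) * y powr (2 * s - 1))
          * (\<integral>\<^sup>+x. ennreal ((cmod (c * ((LINT l|\<eta>. 1 / (Complex x y - complex_of_real l)) - (LINT l|\<rho>. 1 / (Complex x y - complex_of_real l)))))\<^sup>2) \<partial>lborel) \<partial>lborel)"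
    unfolding L_def by (intro nn_integral_cong) (auto simp: continuous_rep_resolvent(1) split: split_indicator)
  also have "\<dots> = ennreal (pi * Gamma (2 * s)) * A"
    unfolding A_def \<psi>_def using s by (intro resolvent_energy eta rho) auto
  also have "\<dots> = ennreal (pi * Gamma (2 * s) * a)" using G a by (simp add: ennreal_mult)
  also have "ennreal_sqrt \<dots> = ennreal (sqrt (pi * Gamma (2 * s) * a))"
    using G a by (simp add: ennreal_sqrt_def)
  finally have rhs: "ennreal_sqrt (\<integral>\<^sup>+y\<in>{0<..}. ennreal (exp (- y) * y powr (2 * s - 1))
          * (\<integral>\<^sup>+x. ennreal ((cmod (L (\<lambda>l. 1 / (Complex x y - complex_of_real l))))\<^sup>2) \<partial>lborel) \<partial>lborel)
        = ennreal (sqrt (pi * Gamma (2 * s) * a))" .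
  have "ennreal ((2 * pi * cmod (L f))\<^sup>2) \<le> A * ennreal ((sobolev_norm s f)\<^sup>2)"
    unfolding L_def A_def \<psi>_def by (rule sobolev_duality[OF eta rho f s])
  also have "\<dots> = ennreal (a * (sobolev_norm s f)\<^sup>2)" using a by (simp add: ennreal_mult)
  finally have "(2 * pi * cmod (L f))\<^sup>2 \<le> (sqrt a * sobolev_norm s f)\<^sup>2"
    using a by (simp add: power_mult_distrib)
  then have "2 * pi * cmod (L f) \<le> sqrt a * sobolev_norm s f"
    by (rule power2_le_imp_le) (use a S in auto)
  then have "cmod (L f) \<le> sqrt a * sobolev_norm s f / (2 * pi)"
    by (simp add: field_simps)
  also have "\<dots> = sobolev_norm s f / (2 * pi powr (3 / 2) * Gamma (2 * s) powr (1 / 2)) * sqrt (pi * Gamma (2 * s) * a)"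
  proof -
    have "pi powr (3 / 2) = pi powr (1 + 1 / 2)" by simp
    also have "\<dots> = pi * sqrt pi" unfolding powr_add by (simp add: powr_half_sqrt)
    finally show ?thesis using G by (simp add: powr_half_sqrt real_sqrt_mult field_simps)
  qed
  finally show ?thesis unfolding rhs using a G S
    by (subst ennreal_mult[symmetric]) (auto intro!: ennreal_leI)
qed

section \<open>Traces of powers and Hermitian spectra\<close>

definition mat_trace :: "complex mat \<Rightarrow> complex" where
  "mat_trace A = (\<Sum>i<dim_row A. A $$ (i, i))"

lemma mat_trace_comm:
  assumes A: "A \<in> carrier_mat n m" and B: "B \<in> carrier_mat m n"
  shows "mat_trace (A * B) = mat_trace (B * A)"
proof -
  have "mat_trace (A * B) = (\<Sum>i<n. \<Sum>j<m. A $$ (i, j) * B $$ (j, i))"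
    using A B by (auto simp: mat_trace_def scalar_prod_def atLeast0LessThan intro!: sum.cong)
  also have "\<dots> = (\<Sum>j<m. \<Sum>i<n. A $$ (i, j) * B $$ (j, i))"
    by (rule sum.swap)
  also have "\<dots> = mat_trace (B * A)"
    using A B by (auto simp: mat_trace_def scalar_prod_def atLeast0LessThan mult.commute intro!: sum.cong)
  finally show ?thesis .
qed

lemma mat_trace_similar:
  assumes "similar_mat_wit A B P Q"
  shows "mat_trace A = mat_trace B"
proof -
  obtain n where n: "n = dim_row A" by simp
  from similar_mat_witD[OF n assms]
  have *: "Q * P = 1\<^sub>m n" "A = P * B * Q" "B \<in> carrier_mat n n" "P \<in> carrier_mat n n" "Q \<in> carrier_mat n n" by auto
  have "mat_trace A = mat_trace (Q * (P * B))"
    unfolding *(2) using * by (intro mat_trace_comm[of _ n n]) auto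
  also have "Q * (P * B) = Q * P * B"
    by (rule assoc_mult_mat[symmetric]) (use * in auto)
  also have "\<dots> = B" unfolding *(1) using *(3) by simp
  finally show ?thesis .
qed

lemma upper_triangular_power:
  assumes B: "(B :: 'a :: comm_semiring_1 mat) \<in> carrier_mat n n" and u: "upper_triangular B"
  shows "upper_triangular (B ^\<^sub>m k) \<and> (\<forall>i<n. (B ^\<^sub>m k) $$ (i, i) = (B $$ (i, i)) ^ k)"
proof (induction k)
  case 0
  then show ?case using B by (auto simp: upper_triangular_def)
next
  case (Suc k)
  let ?P = "B ^\<^sub>m k"
  have P: "?P \<in> carrier_mat n n" using B by auto
  have entry: "(?P * B) $$ (i, j) = (\<Sum>l<n. ?P $$ (i, l) * B $$ (l, j))" if "i < n" "j < n" for i j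
    using that P B by (auto simp: scalar_prod_def atLeast0LessThan)
  have "(?P * B) $$ (i, j) = 0" if "i < n" "j < i" for i j
  proof -
    have "?P $$ (i, l) * B $$ (l, j) = 0" if "l < n" for l
    proof (cases "l < i")
      case True then show ?thesis using Suc P \<open>i < n\<close> by (auto simp: upper_triangular_def)
    next
      case False then show ?thesis using u B \<open>l < n\<close> \<open>j < i\<close> by (auto simp: upper_triangular_def)
    qed
    then show ?thesis using that by (subst entry) auto
  qed
  moreover have "(?P * B) $$ (i, i) = (B $$ (i, i)) ^ Suc k" if "i < n" for i
  proof -
    have "?P $$ (i, l) * B $$ (l, i) = 0" if "l < n" "l \<noteq> i" for l
    proof (cases "l < i")
      case True then show ?thesis using Suc P \<open>i < n\<close> by (auto simp: upper_triangular_def)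
    next
      case False then show ?thesis using u B that by (auto simp: upper_triangular_def)
    qed
    then have "(\<Sum>l<n. ?P $$ (i, l) * B $$ (l, i)) = (\<Sum>l\<in>{i}. ?P $$ (i, l) * B $$ (l, i))"
      using that by (intro sum.mono_neutral_right) auto
    then show ?thesis using that Suc by (subst entry) (auto simp: mult.commute)
  qed
  ultimately show ?case using P B by (auto simp: upper_triangular_def)
qed

lemma proots_linear_factors: "proots (\<Prod>e\<leftarrow>es. [:- e, 1::complex:]) = mset es"
proof (induction es)
  case (Cons e es)
  have "(\<Prod>e\<leftarrow>es. [:- e, 1::complex:]) \<noteq> 0" by (auto simp: prod_list_zero_iff)
  then have "proots ([:- e, 1:] * (\<Prod>e\<leftarrow>es. [:- e, 1::complex:])) = proots [:- e, 1:] + proots (\<Prod>e\<leftarrow>es. [:- e, 1:])"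
    by (intro proots_mult) auto
  then show ?case using Cons by (simp del: mult_pCons_left)
qed simp

text \<open>Power sums of the eigenvalues are traces of powers: a Schur triangularisation carries the
  eigenvalues on its diagonal, and powers of triangular matrices have the powers on the diagonal.\<close>

lemma mat_trace_power:
  assumes A: "A \<in> carrier_mat n n"
  shows "mat_trace (A ^\<^sub>m k) = (\<Sum>e\<in>#proots (char_poly A). e ^ k)"
proof -
  obtain es where es: "char_poly A = (\<Prod>e\<leftarrow>es. [:- e, 1:])"
    using char_poly_factorized[OF A] by auto
  obtain B P Q where "schur_decomposition A es = (B, P, Q)" by (cases "schur_decomposition A es") auto
  from schur_decomposition[OF A es this]
  have sim: "similar_mat_wit A B P Q" and ut: "upper_triangular B" and diag: "diag_mat B = es" by auto
  have B: "B \<in> carrier_mat n n" using similar_mat_witD2[OF A sim] by auto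
  have "similar_mat_wit (A ^\<^sub>m k) (B ^\<^sub>m k) P Q" by (rule similar_mat_wit_pow[OF sim])
  then have "mat_trace (A ^\<^sub>m k) = mat_trace (B ^\<^sub>m k)" by (rule mat_trace_similar)
  also have "\<dots> = (\<Sum>i<n. (B $$ (i, i)) ^ k)"
    using upper_triangular_power[OF B ut] B by (auto simp: mat_trace_def)
  also have "\<dots> = (\<Sum>e\<leftarrow>es. e ^ k)"
    unfolding diag[symmetric] diag_mat_def using B
    by (simp add: interv_sum_list_conv_sum_set_nat o_def atLeast0LessThan)
  also have "\<dots> = (\<Sum>e\<in>#mset es. e ^ k)"
    by (simp add: sum_mset_sum_list[symmetric])
  also have "mset es = proots (char_poly A)"
    unfolding es by (simp add: proots_linear_factors)
  finally show ?thesis .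
qed

lemma mat_adjoint_index:
  assumes "A \<in> carrier_mat n n" "i < n" "j < n"
  shows "mat_adjoint A $$ (i, j) = cnj (A $$ (j, i))"
  using assms unfolding mat_adjoint_def by (simp add: mat_of_rows_index)

text \<open>For an eigenvector \<open>v\<close>, the quadratic form \<open>S\<close> of \<open>A\<close> at \<open>v\<close> is real by symmetry and equals the
  eigenvalue times the positive number \<open>q = \<bar>v\<bar>\<^sup>2\<close>.\<close>

lemma hermitian_root_real:
  assumes A: "A \<in> carrier_mat n n" and herm: "mat_adjoint A = (A :: complex mat)"
    and e: "e \<in># proots (char_poly A)"
  shows "Im e = 0"
proof -
  have "poly (char_poly A) e = 0"
    using e by (metis count_proots not_in_iff order_root proots_0 count_empty)
  then have "eigenvalue A e" by (simp add: eigenvalue_root_char_poly[OF A])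
  then obtain v where v: "v \<in> carrier_vec n" "v \<noteq> 0\<^sub>v n" and Av: "A *\<^sub>v v = e \<cdot>\<^sub>v v"
    using A by (auto simp: eigenvalue_def eigenvector_def)
  have herm': "A $$ (i, j) = cnj (A $$ (j, i))" if "i < n" "j < n" for i j
    using mat_adjoint_index[OF A that] herm by simp
  define S where "S = (\<Sum>i<n. \<Sum>j<n. A $$ (i, j) * v $ j * cnj (v $ i))"
  define q where "q = (\<Sum>i<n. (cmod (v $ i))\<^sup>2)"
  have "cnj S = (\<Sum>i<n. \<Sum>j<n. cnj (A $$ (i, j)) * cnj (v $ j) * v $ i)"
    by (simp add: S_def)
  also have "\<dots> = (\<Sum>j<n. \<Sum>i<n. cnj (A $$ (i, j)) * cnj (v $ j) * v $ i)"
    by (rule sum.swap)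
  also have "\<dots> = S"
    unfolding S_def by (intro sum.cong refl) (simp add: herm'[symmetric] mult_ac)
  finally have S_real: "cnj S = S" .
  have "S = (\<Sum>i<n. e * v $ i * cnj (v $ i))"
  proof -
    have "(\<Sum>j<n. A $$ (i, j) * v $ j) = e * v $ i" if "i < n" for i
    proof -
      have "(A *\<^sub>v v) $ i = (\<Sum>j<n. A $$ (i, j) * v $ j)"
        using A v that by (auto simp: scalar_prod_def atLeast0LessThan)
      then show ?thesis using Av v that by simp
    qed
    then show ?thesis unfolding S_def sum_distrib_right[symmetric] by simp
  qed
  also have "\<dots> = e * of_real q"
    by (simp add: q_def sum_distrib_left complex_norm_square mult.assoc del: of_real_power)
  finally have S_eq: "S = e * of_real q" .
  obtain i where "i < n" "v $ i \<noteq> 0"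
    using v by (metis eq_vecI carrier_vecD index_zero_vec(1) index_zero_vec(2))
  then have "(cmod (v $ i))\<^sup>2 > 0" by simp
  also have "(cmod (v $ i))\<^sup>2 \<le> q"
    unfolding q_def using \<open>i < n\<close> by (intro member_le_sum) auto
  finally have "q > 0" .
  from S_real have "Im S = 0" by (simp add: complex_eq_iff)
  then show ?thesis using S_eq \<open>q > 0\<close> by simp
qed

lemma proots_char_poly_size:
  assumes "A \<in> carrier_mat n n"
  shows "size (proots (char_poly (A :: complex mat))) = n"
  using degree_monic_char_poly[OF assms] by (simp add: size_proots_complex)

section \<open>Measurability of the random spectral measure\<close>

lemma real_distribution_spectral_measure: "real_distribution (spectral_measure A)"
  unfolding spectral_measure_def real_distribution_def real_distribution_axioms_def
  by (auto intro!: prob_space.prob_space_distr measure_pmf.prob_space_axioms)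

lemma sum_mset_eq_sum_count:
  fixes f :: "'a \<Rightarrow> real"
  shows "(\<Sum>x\<in>#m. f x) = (\<Sum>x\<in>set_mset m. real (count m x) * f x)"
proof (induction m)
  case (add a m)
  show ?case
  proof (cases "a \<in># m")
    case True
    then have *: "insert a (set_mset m) = set_mset m" by auto
    have "(\<Sum>x\<in>set_mset m. real (count (add_mset a m) x) * f x)
      = (\<Sum>x\<in>set_mset m. real (count m x) * f x + (if x = a then f x else 0))"
      by (intro sum.cong) (auto simp: algebra_simps)
    with True * add show ?thesis by (simp add: sum.distrib)
  next
    case False
    have "(\<Sum>x\<in>set_mset m. real (count (add_mset a m) x) * f x) = (\<Sum>x\<in>set_mset m. real (count m x) * f x)"
      using False by (intro sum.cong) auto
    then show ?thesis using False add by (simp add: count_eq_zero_iff)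
  qed
qed simp

lemma integral_spectral_measure:
  fixes f :: "real \<Rightarrow> real"
  assumes A: "A \<in> carrier_mat n n" and n: "n \<ge> 1" and [measurable]: "f \<in> borel_measurable borel"
  shows "(LINT x|spectral_measure A. f x) = (\<Sum>e\<in>#proots (char_poly A). f (Re e)) / real n"
proof -
  let ?m = "image_mset Re (proots (char_poly A))"
  have size: "size ?m = n" using proots_char_poly_size[OF A] by simp
  have "?m \<noteq> {#}"
    unfolding size_eq_0_iff_empty[symmetric] size using n by simp
  have "(LINT x|spectral_measure A. f x) = (LINT x|measure_pmf (pmf_of_multiset ?m). f x)"
    unfolding spectral_measure_def by (subst integral_distr) auto
  also have "\<dots> = (\<Sum>x\<in>set_mset ?m. pmf (pmf_of_multiset ?m) x *\<^sub>R f x)"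
    by (intro integral_measure_pmf finite_set_mset) (simp only: set_pmf_of_multiset[OF \<open>?m \<noteq> {#}\<close>])
  also have "\<dots> = (\<Sum>x\<in>set_mset ?m. (real (count ?m x) * f x) / real n)"
    by (intro sum.cong refl) (simp only: pmf_of_multiset[OF \<open>?m \<noteq> {#}\<close>] size real_scaleR_def times_divide_eq_left)
  also have "\<dots> = (\<Sum>x\<in>#?m. f x) / real n"
    unfolding sum_divide_distrib[symmetric] sum_mset_eq_sum_count ..
  also have "(\<Sum>x\<in>#?m. f x) = (\<Sum>e\<in>#proots (char_poly A). f (Re e))"
    by (simp add: image_mset.compositionality o_def)
  finally show ?thesis .
qed

lemma spectral_measure_moment:
  assumes A: "A \<in> carrier_mat n n" and n: "n \<ge> 1" and herm: "mat_adjoint A = A"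
  shows "(LINT x|spectral_measure A. x ^ k) = Re (mat_trace (A ^\<^sub>m k)) / n"
proof -
  have Re_sum: "Re (\<Sum>e\<in>#m. g e) = (\<Sum>e\<in>#m. Re (g e))" for m :: "complex multiset" and g
    by (induction m) auto
  have "Re (e ^ k) = (Re e) ^ k" if "e \<in># proots (char_poly A)" for e
  proof -
    have "e = of_real (Re e)" using hermitian_root_real[OF A herm that] by (simp add: complex_eq_iff)
    then show ?thesis by (metis Re_complex_of_real of_real_power)
  qed
  then have "(\<Sum>e\<in>#proots (char_poly A). (Re e) ^ k) = (\<Sum>e\<in>#proots (char_poly A). Re (e ^ k))"
    by (intro arg_cong[where f=sum_mset] image_mset_cong) auto
  then show ?thesis
    by (subst integral_spectral_measure[OF A n]) (auto simp: mat_trace_power[OF A] Re_sum)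
qed

text \<open>Spectral measures are finitely supported, so pointwise convergence suffices, without any
  domination.\<close>

lemma tendsto_integral_spectral_measure:
  fixes f :: "real \<Rightarrow> real"
  assumes A: "A \<in> carrier_mat n n" and n: "n \<ge> 1"
    and [measurable]: "f \<in> borel_measurable borel" "\<And>k. g k \<in> borel_measurable borel"
    and lim: "\<And>x. (\<lambda>k. g k x) \<longlonglongrightarrow> f x"
  shows "(\<lambda>k. LINT x|spectral_measure A. g k x) \<longlonglongrightarrow> (LINT x|spectral_measure A. f x)"
proof -
  have "(\<lambda>k. \<Sum>e\<in>#m. g k (Re e)) \<longlonglongrightarrow> (\<Sum>e\<in>#m. f (Re e))" for m
    by (induction m) (auto intro!: tendsto_add lim)
  then show ?thesis
    using n by (simp add: integral_spectral_measure[OF A n] tendsto_divide)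
qed

lemma entry_power_measurable:
  assumes X: "\<And>\<omega>. \<omega> \<in> space M \<Longrightarrow> X \<omega> \<in> carrier_mat n n"
    and meas: "\<And>i j. i < n \<Longrightarrow> j < n \<Longrightarrow> (\<lambda>\<omega>. X \<omega> $$ (i, j)) \<in> borel_measurable M"
    and "i < n" "j < n"
  shows "(\<lambda>\<omega>. (X \<omega> ^\<^sub>m k) $$ (i, j) :: complex) \<in> borel_measurable M"
  using \<open>i < n\<close> \<open>j < n\<close>
proof (induction k arbitrary: i j)
  case 0
  have "(X \<omega> ^\<^sub>m 0) $$ (i, j) = (if i = j then 1 else 0)" if "\<omega> \<in> space M" for \<omega>
    using X[OF that] 0 by auto
  then show ?case by (subst measurable_cong) auto
next
  case (Suc k)
  have "(X \<omega> ^\<^sub>m Suc k) $$ (i, j) = (\<Sum>l<n. (X \<omega> ^\<^sub>m k) $$ (i, l) * X \<omega> $$ (l, j))" if "\<omega> \<in> space M" for \<omega>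
    using X[OF that] Suc.prems by (auto simp: scalar_prod_def atLeast0LessThan)
  moreover have "(\<lambda>\<omega>. \<Sum>l<n. (X \<omega> ^\<^sub>m k) $$ (i, l) * X \<omega> $$ (l, j)) \<in> borel_measurable M"
    using Suc meas by (intro borel_measurable_sum borel_measurable_times) auto
  ultimately show ?case by (subst measurable_cong) auto
qed

text \<open>The functions \<open>f\<close> for which \<open>\<integral> f\<close> depends measurably on the matrix include the monomials, because
  the moments are polynomial in the entries, and are closed under pointwise limits. This
  yields successively all polynomials, all continuous functions (by approximation on growing
  intervals) and the indicators of half lines, which generate the Borel sets. The individual
  eigenvalues never have to be chosen measurably.\<close>

lemma spectral_measure_measurable:
  assumes n: "n \<ge> 1"
    and X: "\<And>\<omega>. \<omega> \<in> space M \<Longrightarrow> X \<omega> \<in> carrier_mat n n"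
    and herm: "\<And>\<omega>. \<omega> \<in> space M \<Longrightarrow> mat_adjoint (X \<omega>) = X \<omega>"
    and meas: "\<And>i j. i < n \<Longrightarrow> j < n \<Longrightarrow> (\<lambda>\<omega>. X \<omega> $$ (i, j)) \<in> borel_measurable M"
  shows "(\<lambda>\<omega>. spectral_measure (X \<omega>)) \<in> M \<rightarrow>\<^sub>M prob_algebra borel"
proof -
  have moment: "(\<lambda>\<omega>. LINT x|spectral_measure (X \<omega>). x ^ k) \<in> borel_measurable M" for k
  proof -
    have "(\<lambda>\<omega>. Re (\<Sum>i<n. (X \<omega> ^\<^sub>m k) $$ (i, i)) / n) \<in> borel_measurable M"
      by (intro borel_measurable_divide borel_measurable_const borel_measurable_sum
          measurable_compose[OF _ borel_measurable_Re] entry_power_measurable[OF X meas]) auto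
    moreover have "(LINT x|spectral_measure (X \<omega>). x ^ k) = Re (\<Sum>i<n. (X \<omega> ^\<^sub>m k) $$ (i, i)) / n"
      if "\<omega> \<in> space M" for \<omega>
      using X[OF that] spectral_measure_moment[OF X[OF that] n herm[OF that], of k]
      by (simp add: mat_trace_def)
    ultimately show ?thesis by (subst measurable_cong) auto
  qed
  have limit: "(\<lambda>\<omega>. LINT x|spectral_measure (X \<omega>). f x) \<in> borel_measurable M"
    if g: "\<And>k. (\<lambda>\<omega>. LINT x|spectral_measure (X \<omega>). g k x) \<in> borel_measurable M"
      and "f \<in> borel_measurable borel" "\<And>k. g k \<in> borel_measurable borel"
      and "\<And>x. (\<lambda>k. g k x) \<longlonglongrightarrow> f x" for f and g :: "nat \<Rightarrow> real \<Rightarrow> real"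
  proof (rule borel_measurable_LIMSEQ_real)
    show "(\<lambda>k. LINT x|spectral_measure (X \<omega>). g k x) \<longlonglongrightarrow> (LINT x|spectral_measure (X \<omega>). f x)"
      if "\<omega> \<in> space M" for \<omega>
      by (rule tendsto_integral_spectral_measure[OF X[OF that] n]) fact+
  qed (rule g)
  have polynomial: "(\<lambda>\<omega>. LINT x|spectral_measure (X \<omega>). p x) \<in> borel_measurable M"
    if "real_polynomial_function p" for p
  proof -
    from that obtain a d where p: "p = (\<lambda>x. \<Sum>i\<le>d. a i * x ^ i)"
      unfolding real_polynomial_function_iff_sum by blast
    have swap: "(\<Sum>e\<in>#m. \<Sum>i\<le>d. a i * (Re e) ^ i) = (\<Sum>i\<le>d. a i * (\<Sum>e\<in>#m. (Re e) ^ i))" for m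
      by (induction m) (auto simp: algebra_simps sum.distrib)
    have "(LINT x|spectral_measure (X \<omega>). p x) = (\<Sum>i\<le>d. a i * (LINT x|spectral_measure (X \<omega>). x ^ i))"
      if "\<omega> \<in> space M" for \<omega>
      unfolding p by (simp add: integral_spectral_measure[OF X[OF that] n] swap sum_divide_distrib)
    moreover have "(\<lambda>\<omega>. \<Sum>i\<le>d. a i * (LINT x|spectral_measure (X \<omega>). x ^ i)) \<in> borel_measurable M"
      using moment by (intro borel_measurable_sum borel_measurable_times) auto
    ultimately show ?thesis by (subst measurable_cong) auto
  qed
  have continuous: "(\<lambda>\<omega>. LINT x|spectral_measure (X \<omega>). f x) \<in> borel_measurable M"
    if f: "continuous_on UNIV f" for f :: "real \<Rightarrow> real"
  proof -
    have "\<exists>p. real_polynomial_function p \<and> (\<forall>x\<in>{-real k..real k}. \<bar>f x - p x\<bar> < inverse (real (Suc k)))" for k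
      by (rule Stone_Weierstrass_real_polynomial_function[of "{-real k..real k}" f "inverse (real (Suc k))"])
         (use f continuous_on_subset in auto)
    then obtain p where p: "\<And>k. real_polynomial_function (p k)"
      and close: "\<And>k x. x \<in> {-real k..real k} \<Longrightarrow> \<bar>f x - p k x\<bar> < inverse (real (Suc k))"
      by metis
    have p_meas: "p k \<in> borel_measurable borel" for k
      by (intro borel_measurable_continuous_onI continuous_on_polymonial_function)
         (use p real_polynomial_function_eq in auto)
    have "(\<lambda>k. p k x) \<longlonglongrightarrow> f x" for x
    proof (rule Lim_transform)
      show "(\<lambda>k. f x) \<longlonglongrightarrow> f x" by simp
      show "(\<lambda>k. p k x - f x) \<longlonglongrightarrow> 0"
      proof (rule Lim_null_comparison[OF _ LIMSEQ_inverse_real_of_nat])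
        show "\<forall>\<^sub>F k in sequentially. norm (p k x - f x) \<le> inverse (real (Suc k))"
          using eventually_ge_at_top[of "nat \<lceil>\<bar>x\<bar>\<rceil>"]
        proof eventually_elim
          case (elim k)
          then have "\<bar>x\<bar> \<le> real k" by linarith
          then show ?case using close[of x k] by (simp add: abs_le_iff abs_minus_commute less_imp_le)
        qed
      qed
    qed
    then show ?thesis
      by (intro limit[OF polynomial[OF p]] p_meas borel_measurable_continuous_onI f)
  qed
  have step: "(\<lambda>\<omega>. LINT x|spectral_measure (X \<omega>). indicat_real {..a} x) \<in> borel_measurable M" for a :: real
  proof (rule limit[where g="\<lambda>k x. max 0 (1 - real k * max 0 (x - a))"])
    show "(\<lambda>\<omega>. LINT x|spectral_measure (X \<omega>). max 0 (1 - real k * max 0 (x - a))) \<in> borel_measurable M" for k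
      by (intro continuous continuous_intros)
    show "(\<lambda>k. max 0 (1 - real k * max 0 (x - a))) \<longlonglongrightarrow> indicator {..a} x" for x
    proof (cases "x \<le> a")
      case False
      have "max 0 (1 - real k * max 0 (x - a)) = 0" if "k \<ge> nat \<lceil>1 / (x - a)\<rceil>" for k
      proof -
        from that have "1 / (x - a) \<le> real k" by linarith
        then show ?thesis using False by (simp add: field_simps)
      qed
      then have "\<forall>\<^sub>F k in sequentially. max 0 (1 - real k * max 0 (x - a)) = 0"
        unfolding eventually_sequentially by blast
      then show ?thesis using False by (simp add: tendsto_eventually)
    qed auto
  qed auto
  show ?thesis
  proof (rule measurable_prob_algebra_generated[where \<Omega>=UNIV and G="range atMost"])
    show "sets borel = sigma_sets UNIV (range (atMost :: real \<Rightarrow> real set))"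
      unfolding borel_eq_atMost by (rule sets_measure_of) auto
    show "Int_stable (range (atMost :: real \<Rightarrow> real set))"
      by (auto simp: Int_stable_def)
    show "prob_space (spectral_measure (X \<omega>))" for \<omega>
      using real_distribution_spectral_measure real_distribution_def by blast
    fix A :: "real set" assume "A \<in> range atMost"
    then obtain a where A: "A = {..a}" by auto
    have "emeasure (spectral_measure (X \<omega>)) A = ennreal (LINT x|spectral_measure (X \<omega>). indicat_real {..a} x)" for \<omega>
    proof -
      interpret real_distribution "spectral_measure (X \<omega>)" by (rule real_distribution_spectral_measure)
      show ?thesis unfolding A by (simp add: emeasure_eq_measure)
    qed
    then show "(\<lambda>\<omega>. emeasure (spectral_measure (X \<omega>)) A) \<in> borel_measurable M"
      using step by simp
  qed (auto simp: spectral_measure_def)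
qed

section \<open>The mean spectral measure\<close>

lemma integral_bind_complex:
  fixes f :: "real \<Rightarrow> complex"
  assumes M: "prob_space M" and K: "K \<in> M \<rightarrow>\<^sub>M prob_algebra borel"
    and [measurable]: "f \<in> borel_measurable borel" and bound: "\<And>x. norm (f x) \<le> B"
  shows "(LINT x|(M \<bind> K). f x) = (LINT \<omega>|M. LINT x|K \<omega>. f x)"
proof -
  interpret prob_space M by fact
  have K' [measurable]: "K \<in> M \<rightarrow>\<^sub>M subprob_algebra borel" by (rule measurable_prob_algebraD[OF K])
  have prob: "prob_space (K \<omega>)" "sets (K \<omega>) = sets borel" if "\<omega> \<in> space M" for \<omega>
    using measurable_space[OF K that] by (auto simp: space_prob_algebra)
  have sets_bind: "sets (M \<bind> K) = sets borel"
    by (rule sets_bind[OF sets_kernel[OF K']]) (auto simp: not_empty)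
  interpret bind: prob_space "M \<bind> K"
    by (rule prob_space_bind'[OF _ K]) (simp add: space_prob_algebra M)
  have int_bind: "integrable (M \<bind> K) f"
    by (rule bind.integrable_const_bound[of _ B]) (auto simp: bound measurable_cong_sets[OF sets_bind refl])
  have int_K: "integrable (K \<omega>) f" if "\<omega> \<in> space M" for \<omega>
    by (rule finite_measure.integrable_const_bound[of _ _ B])
       (use prob[OF that] in \<open>auto simp: bound measurable_cong_sets[OF prob(2)[OF that] refl] prob_space.finite_measure\<close>)
  have norm_K: "norm (LINT x|K \<omega>. f x) \<le> B" if "\<omega> \<in> space M" for \<omega>
  proof -
    interpret K: prob_space "K \<omega>" by (rule prob(1)[OF that])
    have "norm (LINT x|K \<omega>. f x) \<le> (LINT x|K \<omega>. norm (f x))" by (rule integral_norm_bound)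
    also have "\<dots> \<le> B" using int_K[OF that] bound by (intro K.integral_le_const) auto
    finally show ?thesis .
  qed
  have int_M: "integrable M (\<lambda>\<omega>. LINT x|K \<omega>. f x)"
    by (rule integrable_const_bound[of _ B])
       (auto simp: norm_K intro!: AE_I2 measurable_compose[OF K' integral_measurable_subprob_algebra])
  have real: "(LINT x|(M \<bind> K). g x) = (LINT \<omega>|M. LINT x|K \<omega>. g x)"
    if [measurable]: "g \<in> borel_measurable borel" and "\<And>x. \<bar>g x\<bar> \<le> B" for g :: "real \<Rightarrow> real"
    by (rule integral_bind[where K=borel and B=B and B'=1])
       (use that in \<open>auto intro!: AE_I2 K' prob_space.emeasure_space_1[THEN eq_refl] prob finite_measure_axioms\<close>)
  show ?thesis
  proof (rule complex_eqI)
    have "Re (LINT x|(M \<bind> K). f x) = (LINT x|(M \<bind> K). Re (f x))" using int_bind by simp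
    also have "\<dots> = (LINT \<omega>|M. LINT x|K \<omega>. Re (f x))"
      by (rule real) (auto intro: order.trans[OF abs_Re_le_cmod bound])
    also have "\<dots> = (LINT \<omega>|M. Re (LINT x|K \<omega>. f x))"
      using int_K by (intro Bochner_Integration.integral_cong) auto
    also have "\<dots> = Re (LINT \<omega>|M. LINT x|K \<omega>. f x)" using int_M by simp
    finally show "Re (LINT x|(M \<bind> K). f x) = Re (LINT \<omega>|M. LINT x|K \<omega>. f x)" .
  next
    have "Im (LINT x|(M \<bind> K). f x) = (LINT x|(M \<bind> K). Im (f x))" using int_bind by simp
    also have "\<dots> = (LINT \<omega>|M. LINT x|K \<omega>. Im (f x))"
      by (rule real) (auto intro: order.trans[OF abs_Im_le_cmod bound])
    also have "\<dots> = (LINT \<omega>|M. Im (LINT x|K \<omega>. f x))"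
      using int_K by (intro Bochner_Integration.integral_cong) auto
    also have "\<dots> = Im (LINT \<omega>|M. LINT x|K \<omega>. f x)" using int_M by simp
    finally show "Im (LINT x|(M \<bind> K). f x) = Im (LINT \<omega>|M. LINT x|K \<omega>. f x)" .
  qed
qed

context deformed_wigner
begin

lemma deformed_matrix_carrier:
  "N \<ge> 1 \<Longrightarrow> \<omega> \<in> space M \<Longrightarrow> deformed_matrix W D N \<omega> \<in> carrier_mat N N"
  unfolding deformed_matrix_def using W_carrier D_carrier by auto

lemma deformed_matrix_entry:
  assumes "N \<ge> 1" "\<omega> \<in> space M" "i < N" "j < N"
  shows "deformed_matrix W D N \<omega> $$ (i, j) = W N \<omega> $$ (i, j) + complex_of_real (D N $$ (i, j))"
  unfolding deformed_matrix_def using W_carrier[of N \<omega>] D_carrier[of N] assms by auto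

lemma W_entry_hermitian:
  assumes "N \<ge> 1" "\<omega> \<in> space M" "i < N" "j < N"
  shows "W N \<omega> $$ (i, j) = cnj (W N \<omega> $$ (j, i))"
  using mat_adjoint_index[OF W_carrier[of N \<omega>]] W_hermitian[of N \<omega>] assms by metis

lemma deformed_matrix_hermitian:
  assumes N: "N \<ge> 1" and \<omega>: "\<omega> \<in> space M"
  shows "mat_adjoint (deformed_matrix W D N \<omega>) = deformed_matrix W D N \<omega>"
proof (rule eq_matI)
  note X = deformed_matrix_carrier[OF N \<omega>]
  fix i j assume "i < dim_row (deformed_matrix W D N \<omega>)" "j < dim_col (deformed_matrix W D N \<omega>)"
  then have ij: "i < N" "j < N" using X by auto
  have D_sym: "D N $$ (j, i) = D N $$ (i, j)"
    using D_diagonal[OF N] D_carrier[OF N] ij by (cases "i = j") (auto simp: diagonal_mat_def)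
  have "mat_adjoint (deformed_matrix W D N \<omega>) $$ (i, j) = cnj (deformed_matrix W D N \<omega> $$ (j, i))"
    by (rule mat_adjoint_index[OF X ij])
  also have "\<dots> = deformed_matrix W D N \<omega> $$ (i, j)"
    using W_entry_hermitian[OF N \<omega>, of i j] ij by (simp add: deformed_matrix_entry[OF N \<omega>] D_sym)
  finally show "mat_adjoint (deformed_matrix W D N \<omega>) $$ (i, j) = deformed_matrix W D N \<omega> $$ (i, j)" .
qed (use deformed_matrix_carrier[OF N \<omega>] in \<open>auto simp: mat_adjoint_def\<close>)

lemma deformed_matrix_entry_measurable:
  assumes N: "N \<ge> 1" and ij: "i < N" "j < N"
  shows "(\<lambda>\<omega>. deformed_matrix W D N \<omega> $$ (i, j)) \<in> borel_measurable M"
proof -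
  have upper: "(\<lambda>\<omega>. W N \<omega> $$ (k, l)) \<in> borel_measurable M" if "k \<le> l" "l < N" for k l
    using W_indep[OF N] that unfolding indep_vars_def by force
  have "(\<lambda>\<omega>. W N \<omega> $$ (i, j)) \<in> borel_measurable M"
  proof (cases "i \<le> j")
    case False
    have "(\<lambda>\<omega>. cnj (W N \<omega> $$ (j, i))) \<in> borel_measurable M"
      using False ij by (intro measurable_compose[OF upper borel_measurable_cnj]) auto
    then show ?thesis
      using W_entry_hermitian[OF N _ ij] by (subst measurable_cong) auto
  qed (use upper ij in auto)
  then have "(\<lambda>\<omega>. W N \<omega> $$ (i, j) + complex_of_real (D N $$ (i, j))) \<in> borel_measurable M"
    by (intro borel_measurable_add) auto
  then show ?thesis
    using deformed_matrix_entry[OF N _ ij] by (subst measurable_cong) auto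
qed

lemma spectral_kernel:
  "N \<ge> 1 \<Longrightarrow> (\<lambda>\<omega>. spectral_measure (deformed_matrix W D N \<omega>)) \<in> M \<rightarrow>\<^sub>M prob_algebra borel"
  by (rule spectral_measure_measurable)
     (auto intro: deformed_matrix_carrier deformed_matrix_hermitian deformed_matrix_entry_measurable)

definition mean_spectral_measure :: "nat \<Rightarrow> real measure" where
  "mean_spectral_measure N = M \<bind> (\<lambda>\<omega>. spectral_measure (deformed_matrix W D N \<omega>))"

lemma real_distribution_mean_spectral_measure:
  assumes N: "N \<ge> 1"
  shows "real_distribution (mean_spectral_measure N)"
proof -
  have M: "M \<in> space (prob_algebra M)" by (simp add: space_prob_algebra prob_space_axioms)
  note K = spectral_kernel[OF N]
  have "prob_space (mean_spectral_measure N)"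
    unfolding mean_spectral_measure_def by (rule prob_space_bind'[OF M K])
  moreover have "sets (mean_spectral_measure N) = sets borel"
    unfolding mean_spectral_measure_def
    by (rule sets_bind) (auto simp: spectral_measure_def not_empty)
  ultimately show ?thesis
    by (simp add: real_distribution_def real_distribution_axioms_def)
qed

lemma bias_eq_mean_spectral_measure:
  assumes N: "N \<ge> 1"
    and cont: "continuous_on UNIV (continuous_rep \<phi>)" and bounded: "bounded (range (continuous_rep \<phi>))"
  shows "bias M (deformed_matrix W D) \<rho> N \<phi>
    = of_nat N * ((LINT x|mean_spectral_measure N. continuous_rep \<phi> x) - (LINT x|\<rho> N. continuous_rep \<phi> x))"
proof -
  obtain B where "\<And>x. norm (continuous_rep \<phi> x) \<le> B"
    using bounded by (auto simp: bounded_iff)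
  then show ?thesis
    unfolding bias_def mean_spectral_measure_def
    by (subst integral_bind_complex[OF prob_space_axioms spectral_kernel[OF N]])
       (auto intro: borel_measurable_continuous_onI cont)
qed

end

section \<open>The bias of Sobolev statistics\<close>

theorem proposition6:
  fixes M :: "'a measure"
    and W :: "nat \<Rightarrow> 'a \<Rightarrow> complex mat"
    and D :: "nat \<Rightarrow> real mat"
    and sigma tau kappa diag_dev :: "nat \<Rightarrow> real"
    and sigma_lim tau_lim kappa_lim diag_dev_lim :: real
    and nu_lim :: "real measure"
    and \<rho> :: "nat \<Rightarrow> real measure"
    and s :: real
  assumes model: "deformed_wigner M W D sigma tau kappa diag_dev
                    sigma_lim tau_lim kappa_lim diag_dev_lim nu_lim"
    and rho: "\<And>N. N \<ge> 1 \<Longrightarrow>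
      semicircular_deformation (spectral_measure (map_mat complex_of_real (D N)))
        (real N * (sigma N)\<^sup>2) (\<rho> N)"
    and s: "s > 1 / 2"
  shows "\<forall>N\<ge>1. \<forall>\<phi> \<in> sobolev s.
    ennreal (cmod (bias M (deformed_matrix W D) \<rho> N \<phi>))
      \<le> ennreal (sobolev_norm s \<phi> / (2 * pi powr (3 / 2) * Gamma (2 * s) powr (1 / 2)))
         * ennreal_sqrt
             (\<integral>\<^sup>+ y \<in> {0<..}. ennreal (exp (- y) * y powr (2 * s - 1))
                * (\<integral>\<^sup>+ x. ennreal ((cmod (bias_resolvent M (deformed_matrix W D) \<rho> N (Complex x y)))\<^sup>2) \<partial>lborel)
              \<partial>lborel)"
proof (intro allI impI ballI)
  fix N :: nat and \<phi> assume N: "N \<ge> 1" and \<phi>: "\<phi> \<in> sobolev s"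
  interpret deformed_wigner M W D sigma tau kappa diag_dev sigma_lim tau_lim kappa_lim diag_dev_lim nu_lim
    by (rule model)
  have eta: "real_distribution (mean_spectral_measure N)"
    by (rule real_distribution_mean_spectral_measure[OF N])
  have rho_N: "real_distribution (\<rho> N)"
    using rho[OF N] by (simp add: semicircular_deformation_def)
  let ?L = "\<lambda>\<phi>. of_real (real N) *
    ((LINT x|mean_spectral_measure N. continuous_rep \<phi> x) - (LINT x|\<rho> N. continuous_rep \<phi> x))"
  have bias: "bias M (deformed_matrix W D) \<rho> N \<phi> = ?L \<phi>"
    using bias_eq_mean_spectral_measure[OF N continuous_rep_sobolev(2,3)[OF \<phi> s]] by simp
  have "bias_resolvent M (deformed_matrix W D) \<rho> N z = ?L (\<lambda>x. 1 / (z - complex_of_real x))" if "Im z \<noteq> 0" for z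
    unfolding bias_resolvent_def
    using bias_eq_mean_spectral_measure[OF N, of "\<lambda>x. 1 / (z - complex_of_real x)"]
      continuous_rep_resolvent[OF that] by simp
  then have "(\<integral>\<^sup>+ y \<in> {0<..}. ennreal (exp (- y) * y powr (2 * s - 1))
      * (\<integral>\<^sup>+ x. ennreal ((cmod (bias_resolvent M (deformed_matrix W D) \<rho> N (Complex x y)))\<^sup>2) \<partial>lborel) \<partial>lborel)
    = (\<integral>\<^sup>+ y \<in> {0<..}. ennreal (exp (- y) * y powr (2 * s - 1))
      * (\<integral>\<^sup>+ x. ennreal ((cmod (?L (\<lambda>l. 1 / (Complex x y - complex_of_real l))))\<^sup>2) \<partial>lborel) \<partial>lborel)"
    by (intro nn_integral_cong) (auto split: split_indicator)
  then show "ennreal (cmod (bias M (deformed_matrix W D) \<rho> N \<phi>))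
      \<le> ennreal (sobolev_norm s \<phi> / (2 * pi powr (3 / 2) * Gamma (2 * s) powr (1 / 2)))
         * ennreal_sqrt
             (\<integral>\<^sup>+ y \<in> {0<..}. ennreal (exp (- y) * y powr (2 * s - 1))
                * (\<integral>\<^sup>+ x. ennreal ((cmod (bias_resolvent M (deformed_matrix W D) \<rho> N (Complex x y)))\<^sup>2) \<partial>lborel)
              \<partial>lborel)"
    unfolding bias using sobolev_resolvent_inequality[OF eta rho_N \<phi> s, of "real N"] by simp
qed

end
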